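(* Let $n\ge 2$ and let $\varphi:\Delta_n\to\mathbb{R}$ be a smooth exponentially concave function such that the Euclidean Hessian of $e^{\varphi}$ is strictly negative definite everywhere on $\Delta_n$. Equip $\Delta_n$ with the geometric structure $(g,\nabla,\nabla^* )$ induced by the L-divergence $T$ of $\varphi$. (i) Let $\gamma:[0,1]\to\Delta_n$ be a primal geodesic. Then the trace (image) of $\gamma$ in $\Delta_n$ is the Euclidean straight line segment in $\Delta_n$ joining $\gamma(0)$ and $\gamma(1)$. (ii) Let $\gamma^*:[0,1]\to\Delta_n$ be a dual geodesic. For each $t$, let $p^*(t)$ be the dual Euclidean coordinate of $\gamma^*(t)$. Then the trace of $p^*$ in $\Delta_n$ is the Euclidean straight line segment in $\Delta_n$ joining $p^*(0)$ and $p^*(1)$.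
   Context: $\Delta_n=\{p\in\mathbb{R}^n: p_i>0,\ \sum_{i=1}^n p_i=1\}$, a smooth $(n-1)$-dimensional manifold. $\nabla\varphi(p)\cdot v$ denotes the directional derivative of $\varphi$ at $p$ along $v\in\mathbb{R}^n$ with $\sum_i v_i=0$; definiteness of the Hessian is with respect to nonzero such $v$. $\varphi$ is exponentially concave if $e^{\varphi}$ is concave. L-divergence: $T(q\mid p)=\log(1+\nabla\varphi(p)\cdot(q-p))-(\varphi(q)-\varphi(p))$. Portfolio map: $\boldsymbol\pi_i(p)=p_i\big(1+\nabla\varphi(p)\cdot(e^{(i)}-p)\big)$, $1\le i\le n$ ($e^{(i)}$ the standard basis); it maps $\Delta_n$ into $\Delta_n$. Coordinates of $p\in\Delta_n$: primal coordinate $\theta_i=\log(p_i/p_n)$, $1\le i\le n-1$; dual coordinate $\phi_i=\theta_i-\log\frac{\boldsymbol\pi_i(p)}{\boldsymbol\pi_n(p)}$, $1\le i\le n-1$, with $\phi_n=0$ (the map $p\mapsto\phi$ is a diffeomorphism onto an open subset of $\mathbb{R}^{n-1}$); dual Euclidean coordinate $p^*\in\Delta_n$, $p^*_i=e^{-\phi_i}/\sum_{j=1}^n e^{-\phi_j}$, $1\le i\le n$. Geometric structure: in any coordinate system $\xi$ of $\Delta_n$, $g_{ij}(\xi)=-\partial_{\xi_i}\partial_{\xi'_j}T(\xi\mid\xi')|_{\xi=\xi'}$; primal connection $\nabla$: $\Gamma_{ijk}(\xi)=-\partial_{\xi_i}\partial_{\xi_j}\partial_{\xi'_k}T(\xi\mid\xi')|_{\xi=\xi'}$;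 dual connection $\nabla^*$: $\Gamma^*_{ijk}(\xi)=-\partial_{\xi_k}\partial_{\xi'_i}\partial_{\xi'_j}T(\xi\mid\xi')|_{\xi=\xi'}$; $\Gamma_{ij}^k=\sum_m\Gamma_{ijm}g^{mk}$, $\Gamma_{ij}^{*k}=\sum_m\Gamma^*_{ijm}g^{mk}$ with $(g^{ij})=(g_{ij})^{-1}$. A smooth curve is a primal (resp. dual) geodesic if in coordinates $\ddot\xi_k+\sum_{i,j}\Gamma_{ij}^k(\xi)\dot\xi_i\dot\xi_j=0$ (resp. with $\Gamma_{ij}^{*k}$) for all $k$. *)

theory Defs
  imports "HOL-Analysis.Analysis"
begin

text \<open>
  The index set \<open>{1, \<dots>, n}\<close> is the type \<^typ>\<open>'m option\<close>, where \<open>'m\<close> is an arbitrary finite type: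
  \<open>Some i\<close> stands for the indices \<open>1, \<dots>, n - 1\<close> and \<open>None\<close> for the last index \<open>n\<close>.
  So coordinates live in \<open>real ^ 'm\<close>, and \<open>n \<ge> 2\<close> holds because types are nonempty.
\<close>

lemma CARD_option_ge_2: "2 \<le> CARD('m::finite option)"
  by (simp add: Suc_le_eq)

definition open_simplex :: "(real ^ ('n::finite)) set" where
  "open_simplex = {p. (\<forall>i. p $ i > 0) \<and> (\<Sum>i\<in>UNIV. p $ i) = 1}"


subsection \<open>Smooth maps\<close>

text \<open>\<open>C\<^sup>k\<close> maps; meant for open \<open>U\<close>.\<close>

primrec Ck_on :: "nat \<Rightarrow> 'a::euclidean_space set \<Rightarrow> ('a \<Rightarrow> 'b::euclidean_space) \<Rightarrow> bool" where
  "Ck_on 0 U f \<longleftrightarrow> continuous_on U f"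
| "Ck_on (Suc k) U f \<longleftrightarrow>
     (\<forall>x\<in>U. f differentiable (at x)) \<and>
     (\<forall>v. Ck_on k U (\<lambda>x. frechet_derivative f (at x) v))"

text \<open>
  Smoothness on an arbitrary subset of a Euclidean space: local smooth extendability to open
  subsets of the ambient space. On an open set this is \<open>C\<^sup>\<infinity>\<close>, on relatively open subsets of
  \<^const>\<open>open_simplex\<close> it is smoothness on the submanifold, and on \<open>{0..1}\<close> it is smoothness up to
  the end points.
\<close>

definition smooth_on :: "'a::euclidean_space set \<Rightarrow> ('a \<Rightarrow> 'b::euclidean_space) \<Rightarrow> bool" where
  "smooth_on S f \<longleftrightarrow>
     (\<forall>x\<in>S. \<exists>U F. open U \<and> x \<in> U \<and> (\<forall>k. Ck_on k U F) \<and> (\<forall>y\<in>U \<inter> S. F y = f y))"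


subsection \<open>Directional derivatives and exponential concavity\<close>

text \<open>
  The directional derivative \<open>\<nabla>f(p) \<cdot> v\<close>. For \<open>p\<close> in the simplex and \<open>v\<close> with zero coordinate sum
  it depends only on the values of \<open>f\<close> on the simplex.
\<close>

definition dir_deriv :: "('a::real_normed_vector \<Rightarrow> real) \<Rightarrow> 'a \<Rightarrow> 'a \<Rightarrow> real" where
  "dir_deriv f p v = deriv (\<lambda>t. f (p + t *\<^sub>R v)) 0"

definition hessian :: "('a::real_normed_vector \<Rightarrow> real) \<Rightarrow> 'a \<Rightarrow> 'a \<Rightarrow> 'a \<Rightarrow> real" where
  "hessian f p u v = dir_deriv (\<lambda>q. dir_deriv f q v) p u"

definition hessian_neg_def_at :: "(real ^ ('n::finite) \<Rightarrow> real) \<Rightarrow> real ^ 'n \<Rightarrow> bool" where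
  "hessian_neg_def_at f p \<longleftrightarrow>
     (\<forall>v. (\<Sum>i\<in>UNIV. v $ i) = 0 \<and> v \<noteq> 0 \<longrightarrow> hessian f p v v < 0)"

definition exp_concave :: "(real ^ ('n::finite) \<Rightarrow> real) \<Rightarrow> bool" where
  "exp_concave \<phi> \<longleftrightarrow> concave_on open_simplex (\<lambda>p. exp (\<phi> p))"


subsection \<open>L-divergence, portfolio map and dual coordinates\<close>

text \<open>\<open>L_div \<phi> q p\<close> is \<open>T(q | p)\<close>.\<close>

definition L_div :: "(real ^ ('n::finite) \<Rightarrow> real) \<Rightarrow> real ^ 'n \<Rightarrow> real ^ 'n \<Rightarrow> real" where
  "L_div \<phi> q p = ln (1 + dir_deriv \<phi> p (q - p)) - (\<phi> q - \<phi> p)"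

definition portfolio :: "(real ^ ('n::finite) \<Rightarrow> real) \<Rightarrow> real ^ 'n \<Rightarrow> real ^ 'n" where
  "portfolio \<phi> p = (\<chi> i. p $ i * (1 + dir_deriv \<phi> p (axis i 1 - p)))"

definition primal_coord :: "real ^ (('m::finite) option) \<Rightarrow> real ^ 'm" where
  "primal_coord p = (\<chi> i. ln (p $ Some i / p $ None))"

definition dual_coord ::
  "(real ^ (('m::finite) option) \<Rightarrow> real) \<Rightarrow> real ^ ('m option) \<Rightarrow> real ^ 'm" where
  "dual_coord \<phi> p =
     (\<chi> i. primal_coord p $ i - ln (portfolio \<phi> p $ Some i / portfolio \<phi> p $ None))"

text \<open>The dual coordinate extended by \<open>\<phi>\<^sub>n = 0\<close>.\<close>

definition dual_coord_ext ::
  "(real ^ (('m::finite) option) \<Rightarrow> real) \<Rightarrow> real ^ ('m option) \<Rightarrow> 'm option \<Rightarrow> real" where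
  "dual_coord_ext \<phi> p i = (case i of None \<Rightarrow> 0 | Some j \<Rightarrow> dual_coord \<phi> p $ j)"

definition dual_euclid ::
  "(real ^ (('m::finite) option) \<Rightarrow> real) \<Rightarrow> real ^ ('m option) \<Rightarrow> real ^ ('m option)" where
  "dual_euclid \<phi> p =
     (\<chi> i. exp (- dual_coord_ext \<phi> p i) / (\<Sum>j\<in>UNIV. exp (- dual_coord_ext \<phi> p j)))"


subsection \<open>The geometric structure induced by the L-divergence\<close>

definition coord_system ::
  "(real ^ (('m::finite) option)) set \<Rightarrow> (real ^ ('m option) \<Rightarrow> real ^ 'm) \<Rightarrow> bool" where
  "coord_system U \<xi> \<longleftrightarrow>
     openin (top_of_set open_simplex) U \<and> inj_on \<xi> U \<and> open (\<xi> ` U) \<and>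
     smooth_on U \<xi> \<and> smooth_on (\<xi> ` U) (inv_into U \<xi>)"

definition partial :: "('m::finite) \<Rightarrow> (real ^ 'm \<Rightarrow> real) \<Rightarrow> real ^ 'm \<Rightarrow> real" where
  "partial i f x = dir_deriv f x (axis i 1)"

text \<open>
  In all of the following, \<open>U\<close> and \<open>\<xi>\<close> are the domain and the map of a coordinate system and \<open>x\<close> is
  a point of \<open>\<xi> ` U\<close>. \<open>L_div_coord \<phi> U \<xi> x y\<close> is \<open>T(\<xi> | \<xi>')\<close> at \<open>\<xi> = x\<close>, \<open>\<xi>' = y\<close>.
\<close>

definition L_div_coord ::
  "(real ^ (('m::finite) option) \<Rightarrow> real) \<Rightarrow> (real ^ ('m option)) set \<Rightarrow>
   (real ^ ('m option) \<Rightarrow> real ^ 'm) \<Rightarrow> real ^ 'm \<Rightarrow> real ^ 'm \<Rightarrow> real" where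
  "L_div_coord \<phi> U \<xi> x y = L_div \<phi> (inv_into U \<xi> x) (inv_into U \<xi> y)"

definition metric ::
  "(real ^ (('m::finite) option) \<Rightarrow> real) \<Rightarrow> (real ^ ('m option)) set \<Rightarrow>
   (real ^ ('m option) \<Rightarrow> real ^ 'm) \<Rightarrow> real ^ 'm \<Rightarrow> real ^ 'm ^ 'm" where
  "metric \<phi> U \<xi> x =
     (\<chi> i j. - partial i (\<lambda>a. partial j (\<lambda>b. L_div_coord \<phi> U \<xi> a b) x) x)"

definition Gamma_primal ::
  "(real ^ (('m::finite) option) \<Rightarrow> real) \<Rightarrow> (real ^ ('m option)) set \<Rightarrow>
   (real ^ ('m option) \<Rightarrow> real ^ 'm) \<Rightarrow> real ^ 'm \<Rightarrow> 'm \<Rightarrow> 'm \<Rightarrow> 'm \<Rightarrow> real" where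
  "Gamma_primal \<phi> U \<xi> x i j k =
     - partial i (\<lambda>a. partial j (\<lambda>a'. partial k (\<lambda>b. L_div_coord \<phi> U \<xi> a' b) x) a) x"

definition Gamma_dual ::
  "(real ^ (('m::finite) option) \<Rightarrow> real) \<Rightarrow> (real ^ ('m option)) set \<Rightarrow>
   (real ^ ('m option) \<Rightarrow> real ^ 'm) \<Rightarrow> real ^ 'm \<Rightarrow> 'm \<Rightarrow> 'm \<Rightarrow> 'm \<Rightarrow> real" where
  "Gamma_dual \<phi> U \<xi> x i j k =
     - partial k (\<lambda>a. partial i (\<lambda>b. partial j (\<lambda>b'. L_div_coord \<phi> U \<xi> a b') b) x) x"

text \<open>Raising the last index: \<open>\<Gamma>\<^sub>i\<^sub>j\<^sup>k = \<Sum>\<^sub>m \<Gamma>\<^sub>i\<^sub>j\<^sub>m g\<^sup>m\<^sup>k\<close>.\<close>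

definition raise_last ::
  "real ^ ('m::finite) ^ 'm \<Rightarrow> ('m \<Rightarrow> 'm \<Rightarrow> 'm \<Rightarrow> real) \<Rightarrow> 'm \<Rightarrow> 'm \<Rightarrow> 'm \<Rightarrow> real" where
  "raise_last g \<Gamma> i j k = (\<Sum>m\<in>UNIV. \<Gamma> i j m * matrix_inv g $ m $ k)"

text \<open>
  The geodesic equation at time \<open>t\<close> for a curve \<open>c\<close> in coordinate space, with Christoffel symbols
  \<open>G x i j k\<close> at \<open>x\<close> (the index \<open>k\<close> raised). Derivatives are relative to \<open>{0..1}\<close>, hence
  one-sided at the end points.
\<close>

definition geodesic_eq_at ::
  "(real ^ ('m::finite) \<Rightarrow> 'm \<Rightarrow> 'm \<Rightarrow> 'm \<Rightarrow> real) \<Rightarrow> (real \<Rightarrow> real ^ 'm) \<Rightarrow> real \<Rightarrow> bool" where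
  "geodesic_eq_at G c t \<longleftrightarrow>
     (let c' = (\<lambda>s. vector_derivative c (at s within {0..1}));
          c'' = vector_derivative c' (at t within {0..1})
      in \<forall>k. c'' $ k + (\<Sum>i\<in>UNIV. \<Sum>j\<in>UNIV. G (c t) i j k * c' t $ i * c' t $ j) = 0)"

text \<open>
  Since the geodesic equation is invariant under changes of coordinates, it is enough to ask for it
  at each time in some coordinate system around the current point.
\<close>

definition primal_geodesic ::
  "(real ^ (('m::finite) option) \<Rightarrow> real) \<Rightarrow> (real \<Rightarrow> real ^ ('m option)) \<Rightarrow> bool" where
  "primal_geodesic \<phi> \<gamma> \<longleftrightarrow>
     \<gamma> ` {0..1} \<subseteq> open_simplex \<and> smooth_on {0..1} \<gamma> \<and>
     (\<forall>t\<in>{0..1}. \<exists>U \<xi>. coord_system U \<xi> \<and> \<gamma> t \<in> U \<and>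
        geodesic_eq_at (\<lambda>x. raise_last (metric \<phi> U \<xi> x) (Gamma_primal \<phi> U \<xi> x))
          (\<lambda>s. \<xi> (\<gamma> s)) t)"

definition dual_geodesic ::
  "(real ^ (('m::finite) option) \<Rightarrow> real) \<Rightarrow> (real \<Rightarrow> real ^ ('m option)) \<Rightarrow> bool" where
  "dual_geodesic \<phi> \<gamma> \<longleftrightarrow>
     \<gamma> ` {0..1} \<subseteq> open_simplex \<and> smooth_on {0..1} \<gamma> \<and>
     (\<forall>t\<in>{0..1}. \<exists>U \<xi>. coord_system U \<xi> \<and> \<gamma> t \<in> U \<and>
        geodesic_eq_at (\<lambda>x. raise_last (metric \<phi> U \<xi> x) (Gamma_dual \<phi> U \<xi> x))
          (\<lambda>s. \<xi> (\<gamma> s)) t)"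

end

theory Submission
  imports Defs
begin

text \<open>
  Put \<open>\<Phi> = exp \<circ> \<phi>\<close> and extend it to the positive orthant by
  \<open>\<Psi> z = s * \<Phi> (z / s)\<close>, where \<open>s\<close> is the sum of the coordinates of \<open>z\<close>. This extension is
  homogeneous of degree one, so by Euler's relation the tangent plane of \<open>\<Phi>\<close> at \<open>p\<close> takes the value
  \<open>grad p \<bullet> q\<close> at \<open>q\<close>, where \<open>grad\<close> is the gradient of \<open>\<Psi>\<close>. Hence the L-divergence is
  \<open>T(q | p) = ln (grad p \<bullet> q) - \<phi> q\<close> (\<open>L_div_eq\<close>), and the dual Euclidean coordinate of \<open>p\<close> is
  \<open>grad p\<close>, rescaled to coordinate sum 1 (\<open>dual_euclid_eq\<close>). Up to terms that depend on one point
  only, \<open>T\<close> is the logarithm of the pairing of \<open>q\<close> with the dual coordinate of \<open>p\<close>, and the two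
  parts of the theorem are the two sides of this projective duality.

  Primal part. The derivative of \<open>T(q | p)\<close> in \<open>p\<close> along a tangent vector \<open>v\<close> is the quotient
  \<open>h q = (\<alpha> \<bullet> q) / (\<beta> \<bullet> q)\<close> of two linear forms, with \<open>\<alpha> = D grad p v\<close>, \<open>\<beta> = grad p\<close> and
  \<open>\<alpha> \<bullet> p = 0\<close>. In every chart, the metric and the primal Christoffel symbols at \<open>p\<close> are the negated
  first and second partial derivatives of these functions \<open>h\<close> at \<open>q = p\<close>. Since the metric is
  invertible, the geodesic equation at time \<open>t\<close> says exactly that \<open>h \<circ> \<gamma>\<close> has vanishing second
  derivative at \<open>t\<close>, for \<open>p = \<gamma> t\<close> and every \<open>v\<close>. The quotient rule turns this into
  \<open>\<alpha> \<bullet> (\<gamma>'' - a \<gamma>') = 0\<close> with \<open>a = 2 (\<beta> \<bullet> \<gamma>') / (\<beta> \<bullet> p)\<close>. As the Hessian of \<open>\<Phi>\<close> is definite on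
  tangent vectors, \<open>\<gamma>'' = a \<gamma>'\<close> follows (\<open>primal_geodesic_acceleration\<close>).

  Dual part. Now \<open>p\<close> runs along the curve and \<open>q\<close> is perturbed. With \<open>w = grad \<circ> \<gamma>\<close>, the geodesic
  equation says that the second time derivative of \<open>ln (w \<bullet> q)\<close> at \<open>t\<close> is stationary in \<open>q\<close> at
  \<open>q = \<gamma> t\<close>. This gives \<open>w'' = a w' + b w\<close> with scalars \<open>a\<close> and \<open>b\<close>
  (\<open>dual_geodesic_acceleration\<close>), and rescaling \<open>w\<close> to coordinate sum 1 removes the last term.

  In both cases the acceleration is a continuous multiple of the velocity. Such a curve runs
  monotonically along a straight line, so its trace is the segment between its end points
  (\<open>image_eq_closed_segment_of_collinear_acceleration\<close>).
\<close>

section \<open>Calculus of smooth maps\<close>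

abbreviation D :: "('a::euclidean_space \<Rightarrow> 'b::euclidean_space) \<Rightarrow> 'a \<Rightarrow> 'a \<Rightarrow> 'b" where
  "D f x \<equiv> frechet_derivative f (at x)"

lemma has_derivative_D:
  "f differentiable (at x) \<Longrightarrow> (f has_derivative D f x) (at x)"
  by (simp add: frechet_derivative_works)

lemma D_eqI: "(f has_derivative f') (at x) \<Longrightarrow> D f x = f'"
  by (metis frechet_derivative_at)

lemma D_expand:
  assumes "f differentiable (at x)"
  shows "D f x v = (\<Sum>b\<in>Basis. (v \<bullet> b) *\<^sub>R D f x b)"
proof -
  have "linear (D f x)" by (rule linear_frechet_derivative[OF assms])
  then have "D f x (\<Sum>b\<in>Basis. (v \<bullet> b) *\<^sub>R b) = (\<Sum>b\<in>Basis. (v \<bullet> b) *\<^sub>R D f x b)"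
    by (simp add: linear_sum linear_cmul)
  then show ?thesis by (simp add: euclidean_representation)
qed

lemma Ck_on_cong:
  assumes "open U" "\<And>x. x \<in> U \<Longrightarrow> f x = g x" "Ck_on k U f"
  shows "Ck_on k U g"
  using assms(2,3)
proof (induction k arbitrary: f g)
  case 0
  then show ?case by (metis Ck_on.simps(1) continuous_on_cong)
next
  case (Suc k)
  have d: "(g has_derivative D f x) (at x)" if "x \<in> U" for x
    using Suc.prems that assms(1)
    by (auto intro!: has_derivative_transform_within_open[OF has_derivative_D])
  show ?case
    unfolding Ck_on.simps
  proof (intro conjI ballI allI)
    show "g differentiable at x" if "x \<in> U" for x
      using d[OF that] by (auto simp: differentiable_def)
    show "Ck_on k U (\<lambda>x. D g x v)" for v
      by (rule Suc.IH[of "\<lambda>x. D f x v"]) (use Suc.prems D_eqI[OF d] in auto)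
  qed
qed

lemma Ck_on_SucI:
  assumes "open U" "\<And>x. x \<in> U \<Longrightarrow> (f has_derivative f' x) (at x)"
    "\<And>v. Ck_on k U (\<lambda>x. f' x v)"
  shows "Ck_on (Suc k) U f"
  unfolding Ck_on.simps
proof (intro conjI ballI allI)
  show "f differentiable at x" if "x \<in> U" for x
    using assms(2)[OF that] by (auto simp: differentiable_def)
  show "Ck_on k U (\<lambda>x. D f x v)" for v
    by (rule Ck_on_cong[OF assms(1) _ assms(3)[of v]]) (simp add: D_eqI[OF assms(2)])
qed

lemma Ck_on_Suc_imp: "Ck_on (Suc k) U f \<Longrightarrow> Ck_on k U f"
proof (induction k arbitrary: f)
  case 0
  then show ?case
    by (auto intro!: differentiable_imp_continuous_on differentiable_at_imp_differentiable_on)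
next
  case (Suc k)
  show ?case unfolding Ck_on.simps(2)[of k] using Suc.prems
    by (auto intro!: Suc.IH simp: Ck_on.simps(2)[of "Suc k"] simp del: Ck_on.simps)
qed

lemma Ck_on_subset: "Ck_on k U f \<Longrightarrow> V \<subseteq> U \<Longrightarrow> Ck_on k V f"
  by (induction k arbitrary: f) (auto intro: continuous_on_subset)

lemma Ck_on_local:
  assumes "\<And>x. x \<in> U \<Longrightarrow> \<exists>N. open N \<and> x \<in> N \<and> Ck_on k N f"
  shows "Ck_on k U f"
  using assms
proof (induction k arbitrary: f)
  case 0
  have "isCont f x" if "x \<in> U" for x
    using 0[OF that] continuous_on_eq_continuous_at by fastforce
  then show ?case by (simp add: continuous_at_imp_continuous_on)
next
  case (Suc k)
  show ?case unfolding Ck_on.simps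
  proof (intro conjI ballI allI)
    show "f differentiable at x" if "x \<in> U" for x using Suc.prems[OF that] by auto
    show "Ck_on k U (\<lambda>x. D f x v)" for v
      by (rule Suc.IH) (use Suc.prems in force)
  qed
qed

lemma Ck_on_const: "open U \<Longrightarrow> Ck_on k U (\<lambda>x. c)"
  by (induction k arbitrary: c) (simp_all)

lemma Ck_on_bounded_linear:
  assumes "bounded_linear L" "open U" shows "Ck_on k U L"
proof (cases k)
  case 0
  then show ?thesis using assms by (simp add: linear_continuous_on)
next
  case (Suc j)
  show ?thesis unfolding Suc
    by (rule Ck_on_SucI[OF assms(2) bounded_linear_imp_has_derivative[OF assms(1)] Ck_on_const[OF assms(2)]])
qed

lemma Ck_on_add:
  assumes "open U" "Ck_on k U f" "Ck_on k U g"
  shows "Ck_on k U (\<lambda>x. f x + g x)"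
  using assms(2,3)
proof (induction k arbitrary: f g)
  case (Suc k)
  show ?case
    by (rule Ck_on_SucI[where f' = "\<lambda>x v. D f x v + D g x v", OF assms(1)])
      (use Suc in \<open>auto intro!: has_derivative_add has_derivative_D\<close>)
qed (auto intro: continuous_intros)

lemma Ck_on_sum:
  assumes "open U" "\<And>i. i \<in> I \<Longrightarrow> Ck_on k U (f i)"
  shows "Ck_on k U (\<lambda>x. \<Sum>i\<in>I. f i x)"
  using assms(2)
  by (induction I rule: infinite_finite_induct)
    (auto intro!: Ck_on_const Ck_on_add assms(1))

lemma Ck_on_bilinear:
  fixes f :: "'a::euclidean_space \<Rightarrow> 'b::euclidean_space" and g :: "'a \<Rightarrow> 'c::euclidean_space"
    and pr :: "'b \<Rightarrow> 'c \<Rightarrow> 'd::euclidean_space"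
  assumes pr: "bounded_bilinear pr" and "open U" "Ck_on k U f" "Ck_on k U g"
  shows "Ck_on k U (\<lambda>x. pr (f x) (g x))"
  using assms(3,4)
proof (induction k arbitrary: f g)
  case 0
  then show ?case by (auto intro: bounded_bilinear.continuous_on[OF pr])
next
  case (Suc k)
  show ?case
  proof (rule Ck_on_SucI[where f' = "\<lambda>x v. pr (f x) (D g x v) + pr (D f x v) (g x)", OF assms(2)])
    show "((\<lambda>x. pr (f x) (g x)) has_derivative (\<lambda>v. pr (f x) (D g x v) + pr (D f x v) (g x))) (at x)"
      if "x \<in> U" for x
      using Suc.prems that by (auto intro!: bounded_bilinear.FDERIV[OF pr] has_derivative_D)
    show "Ck_on k U (\<lambda>x. pr (f x) (D g x v) + pr (D f x v) (g x))" for v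
      using Suc.prems Ck_on_Suc_imp[OF Suc.prems(1)] Ck_on_Suc_imp[OF Suc.prems(2)]
      by (auto intro!: Ck_on_add assms(2) Suc.IH)
  qed
qed

text \<open>
  The derivative of \<open>f \<circ> g\<close> is a sum of products of derivatives of \<open>g\<close> with the functions
  \<open>\<lambda>x. D f (g x) b\<close>, where \<open>b\<close> is a fixed basis vector. Each of the latter is again a composition with
  \<open>g\<close> whose outer map has one order of smoothness less; hence the induction keeps \<open>g\<close> and varies \<open>f\<close>.
\<close>

lemma Ck_on_compose:
  assumes "open U" "open V" "\<And>x. x \<in> U \<Longrightarrow> g x \<in> V" "Ck_on k V f" "Ck_on k U g"
  shows "Ck_on k U (\<lambda>x. f (g x))"
  using assms(4,5)
proof (induction k arbitrary: f)
  case 0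
  then show ?case using assms(3)
    by (auto intro!: continuous_on_compose2[of V f U g])
next
  case (Suc k)
  have g: "Ck_on k U g" by (rule Ck_on_Suc_imp) fact
  show ?case
  proof (rule Ck_on_SucI[where f' = "\<lambda>x v. \<Sum>b\<in>Basis. (D g x v \<bullet> b) *\<^sub>R D f (g x) b", OF assms(1)])
    fix x assume x: "x \<in> U"
    have "((\<lambda>x. f (g x)) has_derivative (\<lambda>v. D f (g x) (D g x v))) (at x)"
      by (rule has_derivative_compose[OF has_derivative_D has_derivative_D])
        (use Suc.prems x assms(3) in auto)
    also have "(\<lambda>v. D f (g x) (D g x v)) = (\<lambda>v. \<Sum>b\<in>Basis. (D g x v \<bullet> b) *\<^sub>R D f (g x) b)"
      using Suc.prems x assms(3) by (intro ext D_expand) auto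
    finally show "((\<lambda>x. f (g x)) has_derivative \<dots>) (at x)" .
  next
    show "Ck_on k U (\<lambda>x. \<Sum>b\<in>Basis. (D g x v \<bullet> b) *\<^sub>R D f (g x) b)" for v
    proof (intro Ck_on_sum Ck_on_bilinear[OF bounded_bilinear_scaleR] assms(1))
      show "Ck_on k U (\<lambda>x. D f (g x) b)" for b
        using Suc.prems by (intro Suc.IH g) auto
      show "Ck_on k U (\<lambda>x. D g x v \<bullet> b)" for b
        using Suc.prems by (intro Ck_on_bilinear[OF bounded_bilinear_inner] assms(1) Ck_on_const) auto
    qed
  qed
qed

lemma Ck_on_exp: "open U \<Longrightarrow> Ck_on k U (exp :: real \<Rightarrow> real)"
proof (induction k)
  case (Suc k)
  have e: "((exp::real\<Rightarrow>real) has_derivative (\<lambda>v. exp x * v)) (at x)" for x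
    using DERIV_exp[of x] by (simp add: has_field_derivative_def)
  show ?case
    by (rule Ck_on_SucI[OF \<open>open U\<close> e Ck_on_bilinear[OF bounded_bilinear_mult]])
      (use Suc in \<open>auto intro: Ck_on_const\<close>)
qed (auto intro: continuous_intros)

lemma Ck_on_inverse: "Ck_on k {0<..} (inverse :: real \<Rightarrow> real)"
proof (induction k)
  case (Suc k)
  have e: "((inverse::real\<Rightarrow>real) has_derivative (\<lambda>v. inverse x * inverse x * (- v))) (at x)" if "x \<in> {0<..}" for x
    using that by (auto intro!: derivative_eq_intros)
  show ?case
    by (rule Ck_on_SucI[OF _ e Ck_on_bilinear[OF bounded_bilinear_mult]])
      (use Suc in \<open>auto intro!: Ck_on_const Ck_on_bilinear[OF bounded_bilinear_mult]\<close>)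
qed (auto intro: continuous_intros)

lemma Ck_on_ln: "Ck_on k {0<..} (ln :: real \<Rightarrow> real)"
proof (cases k)
  case (Suc j)
  have e: "((ln::real\<Rightarrow>real) has_derivative (\<lambda>v. inverse x * v)) (at x)" if "x \<in> {0<..}" for x
    using that by (auto intro!: derivative_eq_intros simp: field_simps)
  show ?thesis unfolding Suc
    by (rule Ck_on_SucI[OF _ e Ck_on_bilinear[OF bounded_bilinear_mult]])
      (auto intro!: Ck_on_const Ck_on_inverse)
qed (auto intro!: continuous_intros)

text \<open>
  Openness is part of the definition because \<^const>\<open>Ck_on\<close> uses full derivatives and is meaningful
  on open sets only.
\<close>

definition Cinf_on :: "'a::euclidean_space set \<Rightarrow> ('a \<Rightarrow> 'b::euclidean_space) \<Rightarrow> bool" where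
  "Cinf_on U f \<longleftrightarrow> open U \<and> (\<forall>k. Ck_on k U f)"

lemma Cinf_on_open: "Cinf_on U f \<Longrightarrow> open U"
  by (simp add: Cinf_on_def)

lemma Cinf_on_differentiable: "Cinf_on U f \<Longrightarrow> x \<in> U \<Longrightarrow> f differentiable (at x)"
  unfolding Cinf_on_def by (metis Ck_on.simps(2))

lemma Cinf_on_has_derivative: "Cinf_on U f \<Longrightarrow> x \<in> U \<Longrightarrow> (f has_derivative D f x) (at x)"
  by (simp add: has_derivative_D Cinf_on_differentiable)

lemma Cinf_on_continuous: "Cinf_on U f \<Longrightarrow> continuous_on U f"
  unfolding Cinf_on_def by (metis Ck_on.simps(1))

lemma Cinf_on_D: "Cinf_on U f \<Longrightarrow> Cinf_on U (\<lambda>x. D f x v)"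
  unfolding Cinf_on_def by (metis Ck_on.simps(2))

lemma Cinf_on_cong: "Cinf_on U f \<Longrightarrow> (\<And>x. x \<in> U \<Longrightarrow> f x = g x) \<Longrightarrow> Cinf_on U g"
  unfolding Cinf_on_def by (metis Ck_on_cong)

lemma Cinf_on_const: "open U \<Longrightarrow> Cinf_on U (\<lambda>x. c)"
  by (simp add: Cinf_on_def Ck_on_const)

lemma Cinf_on_id: "open U \<Longrightarrow> Cinf_on U (\<lambda>x. x)"
  by (simp add: Cinf_on_def Ck_on_bounded_linear bounded_linear_ident)

lemma Cinf_on_add: "Cinf_on U f \<Longrightarrow> Cinf_on U g \<Longrightarrow> Cinf_on U (\<lambda>x. f x + g x)"
  by (simp add: Cinf_on_def Ck_on_add)

lemma Cinf_on_sum: "open U \<Longrightarrow> (\<And>i. i \<in> I \<Longrightarrow> Cinf_on U (f i)) \<Longrightarrow> Cinf_on U (\<lambda>x. \<Sum>i\<in>I. f i x)"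
  by (simp add: Cinf_on_def Ck_on_sum)

lemma Cinf_on_bilinear:
  "bounded_bilinear pr \<Longrightarrow> Cinf_on U f \<Longrightarrow> Cinf_on U g \<Longrightarrow> Cinf_on U (\<lambda>x. pr (f x) (g x))"
  by (simp add: Cinf_on_def Ck_on_bilinear)

lemmas Cinf_on_mult = Cinf_on_bilinear[OF bounded_bilinear_mult]
  and Cinf_on_scaleR = Cinf_on_bilinear[OF bounded_bilinear_scaleR]
  and Cinf_on_inner = Cinf_on_bilinear[OF bounded_bilinear_inner]

lemma Cinf_on_compose:
  "Cinf_on V f \<Longrightarrow> Cinf_on U g \<Longrightarrow> (\<And>x. x \<in> U \<Longrightarrow> g x \<in> V) \<Longrightarrow> Cinf_on U (\<lambda>x. f (g x))"
  unfolding Cinf_on_def by (metis Ck_on_compose)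

lemma Cinf_on_inverse:
  "Cinf_on U f \<Longrightarrow> (\<And>x. x \<in> U \<Longrightarrow> (0::real) < f x) \<Longrightarrow> Cinf_on U (\<lambda>x. inverse (f x))"
  by (rule Cinf_on_compose[where V = "{0<..}"]) (auto simp: Cinf_on_def Ck_on_inverse)

lemma Cinf_on_ln:
  "Cinf_on U f \<Longrightarrow> (\<And>x. x \<in> U \<Longrightarrow> (0::real) < f x) \<Longrightarrow> Cinf_on U (\<lambda>x. ln (f x))"
  by (rule Cinf_on_compose[where V = "{0<..}"]) (auto simp: Cinf_on_def Ck_on_ln)

lemma Cinf_on_exp: "Cinf_on U f \<Longrightarrow> Cinf_on U (\<lambda>x. exp (f x :: real))"
  by (rule Cinf_on_compose[where V = UNIV]) (auto simp: Cinf_on_def Ck_on_exp)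

lemma Cinf_on_local:
  "open U \<Longrightarrow> (\<And>x. x \<in> U \<Longrightarrow> \<exists>N. x \<in> N \<and> Cinf_on N f) \<Longrightarrow> Cinf_on U f"
  unfolding Cinf_on_def by (metis Ck_on_local)

lemma smooth_onE:
  assumes "smooth_on S f" "x \<in> S"
  obtains N F where "x \<in> N" "Cinf_on N F" "\<And>y. y \<in> N \<Longrightarrow> y \<in> S \<Longrightarrow> F y = f y"
proof -
  have "\<exists>N F. open N \<and> x \<in> N \<and> (\<forall>k. Ck_on k N F) \<and> (\<forall>y\<in>N \<inter> S. F y = f y)"
    using assms by (simp add: smooth_on_def)
  then obtain N F where "open N" "x \<in> N" "\<forall>k. Ck_on k N F" "\<forall>y\<in>N \<inter> S. F y = f y"
    by (elim exE conjE)
  then show thesis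
    by (intro that[of N F]) (simp_all add: Cinf_on_def)
qed

text \<open>
  On an open set a local extension agrees with the map itself near each point, so smoothness in the
  sense of extensions gives honest derivatives of the map.
\<close>

lemma smooth_on_open_imp_Cinf_on:
  assumes "open S" "smooth_on S f" shows "Cinf_on S f"
proof (rule Cinf_on_local[OF assms(1)])
  fix x assume "x \<in> S"
  then obtain N F where "x \<in> N" and N: "Cinf_on N F" and F: "\<And>y. y \<in> N \<Longrightarrow> y \<in> S \<Longrightarrow> F y = f y"
    by (rule smooth_onE[OF assms(2)]) (rule that)
  from N have "Cinf_on (N \<inter> S) F"
    using assms(1) unfolding Cinf_on_def by (auto intro: Ck_on_subset)
  then have "Cinf_on (N \<inter> S) f"
    by (rule Cinf_on_cong) (simp add: F)
  then show "\<exists>N. x \<in> N \<and> Cinf_on N f" using \<open>x \<in> N\<close> \<open>x \<in> S\<close> by blast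
qed

text \<open>
  By the mean value theorem, used once along \<open>u\<close> and once along \<open>v\<close>, the second difference quotient is
  a value of the mixed second derivative at a point near \<open>p\<close>.
\<close>

lemma second_difference:
  fixes f :: "'a::euclidean_space \<Rightarrow> real"
  assumes "Cinf_on U f" "p \<in> U" "0 < e"
  shows "\<exists>\<delta>>0. \<forall>h. 0 < h \<and> h < \<delta> \<longrightarrow>
    \<bar>(f (p + h *\<^sub>R u + h *\<^sub>R v) - f (p + h *\<^sub>R u) - f (p + h *\<^sub>R v) + f p) / h\<^sup>2
      - D (\<lambda>x. D f x u) p v\<bar> < e"
proof -
  define H where "H = (\<lambda>x. D (\<lambda>x. D f x u) x v)"
  have "Cinf_on U H" unfolding H_def by (intro Cinf_on_D assms(1))
  then have "isCont H p"
    using Cinf_on_continuous Cinf_on_open assms(2) continuous_on_eq_continuous_at by blast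
  then obtain r1 where r1: "r1 > 0" "\<And>x. dist x p < r1 \<Longrightarrow> \<bar>H x - H p\<bar> < e"
    using assms(3) unfolding continuous_at_eps_delta by (metis dist_real_def)
  obtain r2 where r2: "r2 > 0" "ball p r2 \<subseteq> U"
    using Cinf_on_open[OF assms(1)] assms(2) open_contains_ball by blast
  define r where "r = min r1 r2"
  have r: "r > 0" "\<And>x. dist x p < r \<Longrightarrow> x \<in> U" "\<And>x. dist x p < r \<Longrightarrow> \<bar>H x - H p\<bar> < e"
    using r1 r2 by (auto simp: r_def dist_commute subset_iff)
  define \<delta> where "\<delta> = r / (norm u + norm v + 1)"
  have \<delta>: "\<delta> > 0" using r(1) by (auto simp: \<delta>_def add_nonneg_pos intro!: divide_pos_pos)
  have near: "dist (p + s *\<^sub>R u + t *\<^sub>R v) p < r" if "0 \<le> s" "s \<le> h" "0 \<le> t" "t \<le> h" "h < \<delta>" for s t h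
  proof -
    have "norm (s *\<^sub>R u + t *\<^sub>R v) \<le> s * norm u + t * norm v"
      using that norm_triangle_ineq[of "s *\<^sub>R u" "t *\<^sub>R v"] by simp
    also have "\<dots> \<le> h * norm u + h * norm v"
      using that by (intro add_mono mult_right_mono) auto
    also have "\<dots> \<le> h * (norm u + norm v + 1)"
      using that by (simp add: distrib_left)
    also have "\<dots> < r" using that(5) r(1) norm_ge_zero[of u] norm_ge_zero[of v]
      unfolding \<delta>_def by (simp add: pos_less_divide_eq add_nonneg_pos)
    finally show ?thesis by (simp add: dist_norm add.assoc)
  qed
  have "\<bar>(f (p + h *\<^sub>R u + h *\<^sub>R v) - f (p + h *\<^sub>R u) - f (p + h *\<^sub>R v) + f p) / h\<^sup>2 - H p\<bar> < e"
    if h: "0 < h" "h < \<delta>" for h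
  proof -
    define a where "a = (\<lambda>s. f (p + s *\<^sub>R u + h *\<^sub>R v) - f (p + s *\<^sub>R u + 0 *\<^sub>R v))"
    have fd: "((\<lambda>s. f (p + s *\<^sub>R u + t *\<^sub>R v)) has_real_derivative D f (p + s *\<^sub>R u + t *\<^sub>R v) u) (at s)"
      if "0 \<le> s" "s \<le> h" "0 \<le> t" "t \<le> h" for s t
    proof -
      have "(f has_derivative D f (p + s *\<^sub>R u + t *\<^sub>R v)) (at (p + s *\<^sub>R u + t *\<^sub>R v))"
        using Cinf_on_has_derivative[OF assms(1) r(2)[OF near]] that h by blast
      moreover have "((\<lambda>s. p + s *\<^sub>R u + t *\<^sub>R v) has_derivative (\<lambda>k. k *\<^sub>R u)) (at s)"
        by (auto intro!: derivative_eq_intros)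
      ultimately have "((\<lambda>s. f (p + s *\<^sub>R u + t *\<^sub>R v)) has_derivative (\<lambda>k. D f (p + s *\<^sub>R u + t *\<^sub>R v) (k *\<^sub>R u))) (at s)"
        by (rule has_derivative_compose[rotated])
      then show ?thesis
        using linear_cmul[OF linear_frechet_derivative[OF Cinf_on_differentiable[OF assms(1) r(2)[OF near]]]]
          that h by (simp add: has_field_derivative_def mult.commute[of _ "D f _ u"] mult_commute_abs)
    qed
    have ad: "(a has_real_derivative D f (p + s *\<^sub>R u + h *\<^sub>R v) u - D f (p + s *\<^sub>R u + 0 *\<^sub>R v) u) (at s)"
      if "0 \<le> s" "s \<le> h" for s
      unfolding a_def by (intro DERIV_diff fd) (use that h in auto)
    obtain s where s: "0 < s" "s < h" and sa: "a h - a 0 = (h - 0) * (D f (p + s *\<^sub>R u + h *\<^sub>R v) u - D f (p + s *\<^sub>R u + 0 *\<^sub>R v) u)"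
      using MVT2[of 0 h a, OF h(1) ad] by auto
    have gd: "((\<lambda>t. D f (p + s *\<^sub>R u + t *\<^sub>R v) u) has_real_derivative H (p + s *\<^sub>R u + t *\<^sub>R v)) (at t)"
      if "0 \<le> t" "t \<le> h" for t
    proof -
      have U: "p + s *\<^sub>R u + t *\<^sub>R v \<in> U" by (rule r(2)[OF near[of s h]]) (use that h s in auto)
      have "((\<lambda>x. D f x u) has_derivative D (\<lambda>x. D f x u) (p + s *\<^sub>R u + t *\<^sub>R v)) (at (p + s *\<^sub>R u + t *\<^sub>R v))"
        by (rule Cinf_on_has_derivative[OF Cinf_on_D[OF assms(1)] U])
      moreover have "((\<lambda>t. p + s *\<^sub>R u + t *\<^sub>R v) has_derivative (\<lambda>k. k *\<^sub>R v)) (at t)"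
        by (auto intro!: derivative_eq_intros)
      ultimately have "((\<lambda>t. D f (p + s *\<^sub>R u + t *\<^sub>R v) u) has_derivative (\<lambda>k. D (\<lambda>x. D f x u) (p + s *\<^sub>R u + t *\<^sub>R v) (k *\<^sub>R v))) (at t)"
        by (rule has_derivative_compose[rotated])
      then show ?thesis
        using linear_cmul[OF linear_frechet_derivative[OF Cinf_on_differentiable[OF Cinf_on_D[OF assms(1)] U]]]
        by (simp add: has_field_derivative_def H_def mult_commute_abs)
    qed
    obtain t where t: "0 < t" "t < h" and ta: "D f (p + s *\<^sub>R u + h *\<^sub>R v) u - D f (p + s *\<^sub>R u + 0 *\<^sub>R v) u = (h - 0) * H (p + s *\<^sub>R u + t *\<^sub>R v)"
      using MVT2[of 0 h "\<lambda>t. D f (p + s *\<^sub>R u + t *\<^sub>R v) u", OF h(1) gd] by auto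
    have "(f (p + h *\<^sub>R u + h *\<^sub>R v) - f (p + h *\<^sub>R u) - f (p + h *\<^sub>R v) + f p) / h\<^sup>2 = H (p + s *\<^sub>R u + t *\<^sub>R v)"
      using sa ta h by (simp add: a_def power2_eq_square field_simps)
    then show ?thesis using r(3)[OF near[of s h t]] s t h by simp
  qed
  then show ?thesis using \<delta> unfolding H_def by blast
qed

text \<open>
  Symmetry of second derivatives: interchanging \<open>u\<close> and \<open>v\<close> does not change the second difference
  quotient, which approximates both sides.
\<close>

lemma D_D_commute:
  fixes f :: "'a::euclidean_space \<Rightarrow> real"
  assumes "Cinf_on U f" "p \<in> U"
  shows "D (\<lambda>x. D f x u) p v = D (\<lambda>x. D f x v) p u"
proof (rule ccontr)
  assume neq: "\<not> ?thesis"
  define e where "e = \<bar>D (\<lambda>x. D f x u) p v - D (\<lambda>x. D f x v) p u\<bar> / 2"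
  have e: "e > 0" using neq by (simp add: e_def)
  define q where "q = (\<lambda>h. (f (p + h *\<^sub>R u + h *\<^sub>R v) - f (p + h *\<^sub>R u) - f (p + h *\<^sub>R v) + f p) / h\<^sup>2)"
  obtain d1 where d1: "d1 > 0" "\<And>h. 0 < h \<Longrightarrow> h < d1 \<Longrightarrow> \<bar>q h - D (\<lambda>x. D f x u) p v\<bar> < e"
    using second_difference[OF assms e, of u v] unfolding q_def by blast
  have swap: "q h = (f (p + h *\<^sub>R v + h *\<^sub>R u) - f (p + h *\<^sub>R v) - f (p + h *\<^sub>R u) + f p) / h\<^sup>2" for h
    by (simp add: q_def algebra_simps)
  obtain d2 where d2: "d2 > 0" "\<And>h. 0 < h \<Longrightarrow> h < d2 \<Longrightarrow> \<bar>q h - D (\<lambda>x. D f x v) p u\<bar> < e"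
    using second_difference[OF assms e, of v u] unfolding swap by blast
  define h where "h = min d1 d2 / 2"
  have "0 < h" "h < d1" "h < d2" using d1(1) d2(1) by (auto simp: h_def)
  with d1(2)[of h] d2(2)[of h] show False unfolding e_def by argo
qed

section \<open>Second derivatives along curves\<close>

text \<open>
  Derivatives relative to \<open>{0..1}\<close>, as in the geodesic equation. The first derivative is required on a
  neighbourhood of \<open>t\<close> only, because a curve has an expression in a given chart only locally.
\<close>

definition twice_deriv_at ::
  "(real \<Rightarrow> 'a::real_normed_vector) \<Rightarrow> (real \<Rightarrow> 'a) \<Rightarrow> 'a \<Rightarrow> real \<Rightarrow> bool" where
  "twice_deriv_at f f' f'' t \<longleftrightarrow> t \<in> {0..1} \<and>
     (\<exists>N. open N \<and> t \<in> N \<and> (\<forall>s\<in>N \<inter> {0..1}. (f has_vector_derivative f' s) (at s within {0..1}))) \<and>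
     (f' has_vector_derivative f'') (at t within {0..1})"

lemma twice_deriv_atI:
  assumes "t \<in> {0..1}" "open N" "t \<in> N"
    "\<And>s. s \<in> N \<inter> {0..1} \<Longrightarrow> (f has_vector_derivative f' s) (at s within {0..1})"
    "(f' has_vector_derivative f'') (at t within {0..1})"
  shows "twice_deriv_at f f' f'' t"
  unfolding twice_deriv_at_def
  by (intro conjI exI[of _ N] ballI assms)

lemma twice_deriv_atE:
  assumes "twice_deriv_at f f' f'' t"
  obtains N where "open N" "t \<in> N"
    "\<And>s. s \<in> N \<inter> {0..1} \<Longrightarrow> (f has_vector_derivative f' s) (at s within {0..1})"
proof -
  from assms obtain N where "open N \<and> t \<in> N \<and>
      (\<forall>s\<in>N \<inter> {0..1}. (f has_vector_derivative f' s) (at s within {0..1}))"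
    unfolding twice_deriv_at_def by (elim conjE exE) (rule that, intro conjI)
  then show thesis by (intro that[of N]) simp_all
qed

lemma twice_deriv_at_range: "twice_deriv_at f f' f'' t \<Longrightarrow> t \<in> {0..1}"
  by (simp add: twice_deriv_at_def)

lemma twice_deriv_at_deriv2:
  "twice_deriv_at f f' f'' t \<Longrightarrow> (f' has_vector_derivative f'') (at t within {0..1})"
  by (simp add: twice_deriv_at_def)

lemma twice_deriv_at_deriv:
  assumes "twice_deriv_at f f' f'' t"
  shows "(f has_vector_derivative f' t) (at t within {0..1})"
proof -
  obtain N where "t \<in> N" and N: "\<And>s. s \<in> N \<inter> {0..1} \<Longrightarrow> (f has_vector_derivative f' s) (at s within {0..1})"
    by (rule twice_deriv_atE[OF assms]) (rule that)
  then show ?thesis using twice_deriv_at_range[OF assms] by simp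
qed

lemma has_vector_derivative_cong_near:
  assumes "(f has_vector_derivative f') (at t within S)" "t \<in> S"
    "open N" "t \<in> N" "\<And>s. s \<in> N \<Longrightarrow> s \<in> S \<Longrightarrow> f s = g s"
  shows "(g has_vector_derivative f') (at t within S)"
proof -
  obtain e where "e > 0" "ball t e \<subseteq> N"
    using assms(3,4) open_contains_ball by blast
  then show ?thesis
    using assms by (intro has_vector_derivative_transform_within[OF assms(1), of e]) (auto simp: dist_commute subset_iff)
qed

lemma vector_derivative_unique_unit_interval:
  assumes "t \<in> {0..1}" "(f has_vector_derivative f') (at t within {0..1::real})"
    "(f has_vector_derivative f'') (at t within {0..1})"
  shows "f' = f''"
  by (rule vector_derivative_unique_within[OF _ assms(2,3)])
    (use assms(1) in \<open>simp add: trivial_limit_within\<close>)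

lemma twice_deriv_at_unique:
  assumes "twice_deriv_at f f1 f2 t" "twice_deriv_at f g1 g2 t"
  shows "f1 t = g1 t" "f2 = g2"
proof -
  have t: "t \<in> {0..1}" using assms(1) by (simp add: twice_deriv_at_def)
  show "f1 t = g1 t"
    by (rule vector_derivative_unique_unit_interval[OF t assms[THEN twice_deriv_at_deriv]])
  obtain N where N: "open N" "t \<in> N" "\<And>s. s \<in> N \<inter> {0..1} \<Longrightarrow> (f has_vector_derivative f1 s) (at s within {0..1})"
    by (rule twice_deriv_atE[OF assms(1)]) (rule that)
  obtain M where M: "open M" "t \<in> M" "\<And>s. s \<in> M \<inter> {0..1} \<Longrightarrow> (f has_vector_derivative g1 s) (at s within {0..1})"
    by (rule twice_deriv_atE[OF assms(2)]) (rule that)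
  have "f1 s = g1 s" if "s \<in> N \<inter> M" "s \<in> {0..1}" for s
    using that N(3) M(3) by (intro vector_derivative_unique_unit_interval[of s f]) auto
  then have "(g1 has_vector_derivative f2) (at t within {0..1})"
    using t N(1,2) M(1,2)
    by (intro has_vector_derivative_cong_near[OF twice_deriv_at_deriv2[OF assms(1)], of "N \<inter> M"]) auto
  then show "f2 = g2"
    by (rule vector_derivative_unique_unit_interval[OF t _ twice_deriv_at_deriv2[OF assms(2)]])
qed

lemma twice_deriv_at_cong:
  assumes "twice_deriv_at f f1 f2 t" "open M" "t \<in> M" "\<And>s. s \<in> M \<Longrightarrow> s \<in> {0..1} \<Longrightarrow> f s = g s"
  shows "twice_deriv_at g f1 f2 t"
proof -
  obtain N where N: "open N" "t \<in> N" "\<And>s. s \<in> N \<inter> {0..1} \<Longrightarrow> (f has_vector_derivative f1 s) (at s within {0..1})"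
    by (rule twice_deriv_atE[OF assms(1)]) (rule that)
  have "(g has_vector_derivative f1 s) (at s within {0..1})" if "s \<in> (N \<inter> M) \<inter> {0..1}" for s
    by (rule has_vector_derivative_cong_near[OF N(3), of s M]) (use that assms in auto)
  moreover have "open (N \<inter> M)" "t \<in> N \<inter> M" using N(1,2) assms(2,3) by auto
  ultimately show ?thesis
    by (intro twice_deriv_atI[OF twice_deriv_at_range[OF assms(1)], of "N \<inter> M"] twice_deriv_at_deriv2[OF assms(1)])
qed

lemma twice_deriv_at_vector_derivative:
  assumes "twice_deriv_at f f1 f2 t"
  defines "f' \<equiv> \<lambda>s. vector_derivative f (at s within {0..1})"
  shows "twice_deriv_at f f' f2 t" "f' t = f1 t" "vector_derivative f' (at t within {0..1}) = f2"
proof -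
  have t: "t \<in> {0..1}" by (rule twice_deriv_at_range[OF assms(1)])
  obtain N where N: "open N" "t \<in> N" "\<And>s. s \<in> N \<inter> {0..1} \<Longrightarrow> (f has_vector_derivative f1 s) (at s within {0..1})"
    by (rule twice_deriv_atE[OF assms(1)]) (rule that)
  have vd: "vector_derivative g (at s within {0..1}) = g'"
    if "(g has_vector_derivative g') (at s within {0..1})" "s \<in> {0..1}" for g :: "real \<Rightarrow> 'a" and g' s
    by (rule vector_derivative_within[OF _ that(1)]) (use that(2) in \<open>simp add: trivial_limit_within\<close>)
  have eq: "f' s = f1 s" if "s \<in> N \<inter> {0..1}" for s
    unfolding f'_def by (rule vd[OF N(3)[OF that]]) (use that in simp)
  show "f' t = f1 t" using N(2) t by (intro eq) simp
  have f': "(f' has_vector_derivative f2) (at t within {0..1})"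
    by (rule has_vector_derivative_cong_near[OF twice_deriv_at_deriv2[OF assms(1)], of N])
      (use N(1,2) t eq in simp_all)
  then show "vector_derivative f' (at t within {0..1}) = f2"
    by (rule vd[OF _ t])
  show "twice_deriv_at f f' f2 t"
    by (rule twice_deriv_atI[OF t N(1,2) _ f']) (simp only: eq N(3))
qed

lemma twice_deriv_at_linear:
  assumes "bounded_linear L" "twice_deriv_at f f1 f2 t"
  shows "twice_deriv_at (\<lambda>s. L (f s)) (\<lambda>s. L (f1 s)) (L f2) t"
proof -
  obtain N where N: "open N" "t \<in> N" "\<And>s. s \<in> N \<inter> {0..1} \<Longrightarrow> (f has_vector_derivative f1 s) (at s within {0..1})"
    by (rule twice_deriv_atE[OF assms(2)]) (rule that)
  show ?thesis
    by (rule twice_deriv_atI[OF twice_deriv_at_range[OF assms(2)] N(1,2)])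
      (intro bounded_linear.has_vector_derivative[OF assms(1)] N(3) twice_deriv_at_deriv2[OF assms(2)], assumption?)+
qed

lemma twice_deriv_at_divide:
  fixes f g :: "real \<Rightarrow> real"
  assumes "twice_deriv_at f f1 f2 t" "twice_deriv_at g g1 g2 t" "\<And>s. s \<in> {0..1} \<Longrightarrow> g s \<noteq> 0"
  shows "twice_deriv_at (\<lambda>s. f s / g s) (\<lambda>s. (f1 s * g s - f s * g1 s) / (g s * g s))
    (f2 / g t - 2 * f1 t * g1 t / (g t)^2 - f t * g2 / (g t)^2 + 2 * f t * (g1 t)^2 / (g t)^3) t"
proof -
  have t: "t \<in> {0..1}" using assms by (simp add: twice_deriv_at_def)
  obtain N where N: "open N" "t \<in> N" "\<And>s. s \<in> N \<inter> {0..1} \<Longrightarrow> (f has_real_derivative f1 s) (at s within {0..1})"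
    by (rule twice_deriv_atE[OF assms(1)]) (rule that[unfolded has_real_derivative_iff_has_vector_derivative])
  obtain M where M: "open M" "t \<in> M" "\<And>s. s \<in> M \<inter> {0..1} \<Longrightarrow> (g has_real_derivative g1 s) (at s within {0..1})"
    by (rule twice_deriv_atE[OF assms(2)]) (rule that[unfolded has_real_derivative_iff_has_vector_derivative])
  have "((\<lambda>s. f s / g s) has_real_derivative (f1 s * g s - f s * g1 s) / (g s * g s)) (at s within {0..1})"
    if "s \<in> (N \<inter> M) \<inter> {0..1}" for s
    using that by (intro DERIV_divide N(3) M(3) assms(3)) auto
  moreover have "open (N \<inter> M)" "t \<in> N \<inter> M" using N(1,2) M(1,2) by auto
  moreover have "((\<lambda>s. (f1 s * g s - f s * g1 s) / (g s * g s)) has_real_derivative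
      (f2 / g t - 2 * f1 t * g1 t / (g t)^2 - f t * g2 / (g t)^2 + 2 * f t * (g1 t)^2 / (g t)^3)) (at t within {0..1})"
  proof -
    have f': "(f has_real_derivative f1 t) (at t within {0..1})" using N t by blast
    have g': "(g has_real_derivative g1 t) (at t within {0..1})" using M t by blast
    have f'': "(f1 has_real_derivative f2) (at t within {0..1})" "(g1 has_real_derivative g2) (at t within {0..1})"
      using assms(1,2)[THEN twice_deriv_at_deriv2] by (simp_all add: has_real_derivative_iff_has_vector_derivative)
    have "g t \<noteq> 0" using assms(3) t .
    then show ?thesis
      by (auto intro!: derivative_eq_intros f' g' f'' simp: field_simps power2_eq_square power3_eq_cube)
  qed
  ultimately show ?thesis
    unfolding has_real_derivative_iff_has_vector_derivative by (intro twice_deriv_atI[OF t, of "N \<inter> M"])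
qed

lemma twice_deriv_at_ln:
  fixes f :: "real \<Rightarrow> real"
  assumes "twice_deriv_at f f1 f2 t" "\<And>s. s \<in> {0..1} \<Longrightarrow> f s > 0"
  shows "twice_deriv_at (\<lambda>s. ln (f s)) (\<lambda>s. f1 s / f s) (f2 / f t - (f1 t / f t)^2) t"
proof -
  have t: "t \<in> {0..1}" using assms by (simp add: twice_deriv_at_def)
  obtain N where N: "open N" "t \<in> N" "\<And>s. s \<in> N \<inter> {0..1} \<Longrightarrow> (f has_real_derivative f1 s) (at s within {0..1})"
    by (rule twice_deriv_atE[OF assms(1)]) (rule that[unfolded has_real_derivative_iff_has_vector_derivative])
  have "((\<lambda>s. ln (f s)) has_real_derivative f1 s / f s) (at s within {0..1})"
    if "s \<in> N \<inter> {0..1}" for s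
    using that assms(2)[of s] by (auto intro!: derivative_eq_intros N(3))
  moreover have "((\<lambda>s. f1 s / f s) has_real_derivative (f2 / f t - (f1 t / f t)^2)) (at t within {0..1})"
  proof -
    have f': "(f has_real_derivative f1 t) (at t within {0..1})" using N t by blast
    have f'': "(f1 has_real_derivative f2) (at t within {0..1})"
      using assms(1)[THEN twice_deriv_at_deriv2] by (simp_all add: has_real_derivative_iff_has_vector_derivative)
    have "f t > 0" using assms(2) t .
    then show ?thesis
      by (auto intro!: derivative_eq_intros f' f'' simp: field_simps power2_eq_square)
  qed
  ultimately show ?thesis
    unfolding has_real_derivative_iff_has_vector_derivative by (intro twice_deriv_atI[OF t N(1,2)])
qed

text \<open>
  The value is written in coordinates: the contraction of second and first partial derivatives with the
  velocity and the acceleration is the shape in which the geodesic equation presents itself.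
\<close>

lemma twice_deriv_at_compose:
  fixes f :: "real \<Rightarrow> 'a::euclidean_space"
  assumes F: "Cinf_on U F" and f: "twice_deriv_at f f1 f2 t" and U: "f t \<in> U"
  shows "twice_deriv_at (\<lambda>s. F (f s)) (\<lambda>s. D F (f s) (f1 s))
    ((\<Sum>i\<in>Basis. \<Sum>j\<in>Basis. (f1 t \<bullet> i) *\<^sub>R (f1 t \<bullet> j) *\<^sub>R D (\<lambda>x. D F x j) (f t) i)
      + (\<Sum>i\<in>Basis. (f2 \<bullet> i) *\<^sub>R D F (f t) i)) t"
proof -
  have t: "t \<in> {0..1}" using f by (simp add: twice_deriv_at_def)
  obtain N where N: "open N" "t \<in> N" "\<And>s. s \<in> N \<inter> {0..1} \<Longrightarrow> (f has_vector_derivative f1 s) (at s within {0..1})"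
    by (rule twice_deriv_atE[OF f]) (rule that)
  have "continuous_on (N \<inter> {0..1}) f"
    unfolding continuous_on_eq_continuous_within
    by (intro ballI continuous_within_subset[OF has_vector_derivative_continuous[OF N(3)]]) auto
  then obtain M where M: "open M" "M \<inter> (N \<inter> {0..1}) = f -` U \<inter> (N \<inter> {0..1})"
    using Cinf_on_open[OF F] unfolding continuous_on_open_invariant by blast
  have tM: "t \<in> M" using M(2) U N(2) t by blast
  have dF: "((\<lambda>s. F (f s)) has_vector_derivative D F (f s) v) (at s within {0..1})"
    if "Cinf_on U F" "(f has_vector_derivative v) (at s within {0..1})" "f s \<in> U" for F :: "'a \<Rightarrow> 'b" and s v
    using vector_derivative_diff_chain_within[OF that(2) has_derivative_at_withinI[OF Cinf_on_has_derivative[OF that(1,3)]]]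
    by (simp add: o_def)
  have d1: "((\<lambda>s. F (f s)) has_vector_derivative D F (f s) (f1 s)) (at s within {0..1})"
    if "s \<in> (N \<inter> M) \<inter> {0..1}" for s
    by (rule dF[OF F N(3)]) (use that M(2) in auto)
  have "((\<lambda>s. \<Sum>j\<in>Basis. (f1 s \<bullet> j) *\<^sub>R D F (f s) j) has_vector_derivative
      (\<Sum>j\<in>Basis. (f1 t \<bullet> j) *\<^sub>R D (\<lambda>x. D F x j) (f t) (f1 t) + (f2 \<bullet> j) *\<^sub>R D F (f t) j)) (at t within {0..1})"
  proof (intro has_vector_derivative_sum has_vector_derivative_scaleR)
    fix j :: 'a
    have "((\<lambda>s. f1 s \<bullet> j) has_vector_derivative f2 \<bullet> j) (at t within {0..1})"
      by (intro bounded_linear.has_vector_derivative[OF bounded_linear_inner_left] twice_deriv_at_deriv2[OF f])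
    then show "((\<lambda>s. f1 s \<bullet> j) has_real_derivative f2 \<bullet> j) (at t within {0..1})"
      by (simp add: has_real_derivative_iff_has_vector_derivative)
    show "((\<lambda>s. D F (f s) j) has_vector_derivative D (\<lambda>x. D F x j) (f t) (f1 t)) (at t within {0..1})"
      using N t U by (intro dF[OF Cinf_on_D[OF F]]) auto
  qed
  moreover have "(\<Sum>j\<in>Basis. (f1 s \<bullet> j) *\<^sub>R D F (f s) j) = D F (f s) (f1 s)" if "s \<in> M \<inter> N" "s \<in> {0..1}" for s
  proof -
    have "f s \<in> U" using M(2) that by blast
    then show ?thesis by (rule D_expand[OF Cinf_on_differentiable[OF F], symmetric])
  qed
  ultimately have "((\<lambda>s. D F (f s) (f1 s)) has_vector_derivative
      (\<Sum>j\<in>Basis. (f1 t \<bullet> j) *\<^sub>R D (\<lambda>x. D F x j) (f t) (f1 t) + (f2 \<bullet> j) *\<^sub>R D F (f t) j)) (at t within {0..1})"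
    by (elim has_vector_derivative_cong_near[OF _ t, of _ _ "M \<inter> N"]) (use tM M N in \<open>simp_all add: open_Int\<close>)
  moreover have "(\<Sum>j\<in>Basis. (f1 t \<bullet> j) *\<^sub>R D (\<lambda>x. D F x j) (f t) (f1 t) + (f2 \<bullet> j) *\<^sub>R D F (f t) j)
    = (\<Sum>i\<in>Basis. \<Sum>j\<in>Basis. (f1 t \<bullet> i) *\<^sub>R (f1 t \<bullet> j) *\<^sub>R D (\<lambda>x. D F x j) (f t) i)
      + (\<Sum>i\<in>Basis. (f2 \<bullet> i) *\<^sub>R D F (f t) i)"
  proof -
    have "D (\<lambda>x. D F x j) (f t) (f1 t) = (\<Sum>i\<in>Basis. (f1 t \<bullet> i) *\<^sub>R D (\<lambda>x. D F x j) (f t) i)" for j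
      by (rule D_expand[OF Cinf_on_differentiable[OF Cinf_on_D[OF F] U]])
    then show ?thesis
      by (simp add: sum.distrib scaleR_right.sum)
        (subst sum.swap, simp add: mult.commute)
  qed
  moreover have "open (N \<inter> M)" "t \<in> N \<inter> M" using N(1,2) M(1) tM by auto
  ultimately show ?thesis
    by (intro twice_deriv_atI[OF t, of "N \<inter> M"] d1) simp_all
qed

lemma smooth_on_imp_twice_deriv_at:
  fixes f :: "real \<Rightarrow> 'a::euclidean_space"
  assumes "smooth_on {0..1} f" "t \<in> {0..1}"
  defines "f' \<equiv> \<lambda>s. vector_derivative f (at s within {0..1})"
  shows "twice_deriv_at f f' (vector_derivative f' (at t within {0..1})) t"
proof -
  obtain N F where N: "t \<in> N" "Cinf_on N F" "\<And>y. y \<in> N \<Longrightarrow> y \<in> {0..1} \<Longrightarrow> F y = f y"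
    by (rule smooth_onE[OF assms(1,2)]) (rule that)
  have "twice_deriv_at (\<lambda>s. s) (\<lambda>s. 1) 0 t"
    by (rule twice_deriv_atI[OF assms(2) open_UNIV]) (auto intro: derivative_eq_intros)
  from twice_deriv_at_cong[OF twice_deriv_at_compose[OF N(2) this N(1)] Cinf_on_open[OF N(2)] N(1,3)]
  obtain f1 f2 where *: "twice_deriv_at f f1 f2 t"
    by (rule that)
  show ?thesis
    using twice_deriv_at_vector_derivative(1)[OF *] twice_deriv_at_vector_derivative(3)[OF *]
    by (simp add: f'_def)
qed

text \<open>
  The equation \<open>u'' = a u'\<close> is linear in \<open>u'\<close>, so \<open>u'\<close> is a positive multiple of its initial value \<open>v\<close>,
  and \<open>u\<close> is \<open>u 0 + f v\<close> with an increasing real function \<open>f\<close>.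
\<close>

lemma image_eq_closed_segment_of_collinear_acceleration:
  fixes u :: "real \<Rightarrow> 'a::euclidean_space"
  assumes u: "\<And>t. t \<in> {0..1} \<Longrightarrow> (u has_vector_derivative u1 t) (at t within {0..1})"
    and u1: "\<And>t. t \<in> {0..1} \<Longrightarrow> (u1 has_vector_derivative a t *\<^sub>R u1 t) (at t within {0..1})"
    and a: "continuous_on {0..1} a"
  shows "u ` {0..1} = closed_segment (u 0) (u 1)"
proof -
  have const: "f t = f 0" if "\<And>t. t \<in> {0..1} \<Longrightarrow> (f has_vector_derivative 0) (at t within {0..1})" "t \<in> {0..1}"
    for f :: "real \<Rightarrow> 'a" and t
  proof -
    have "\<exists>c. \<forall>x\<in>{0..1}. f x = c"
      by (rule has_derivative_zero_constant) (use that(1) in \<open>simp_all add: has_vector_derivative_def\<close>)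
    then obtain c where "\<forall>x\<in>{0..1}. f x = c" ..
    then show ?thesis using that(2) by simp
  qed
  define v where "v = u1 0"
  \<comment> \<open>\<open>exp (- A)\<close> is the integrating factor of \<open>u'' = a u'\<close>.\<close>
  define A where "A = (\<lambda>t. integral {0..t} a)"
  have A: "(A has_real_derivative a t) (at t within {0..1})" if "t \<in> {0..1}" for t
    unfolding A_def has_real_derivative_iff_has_vector_derivative
    by (rule integral_has_vector_derivative[OF a that])
  have "((\<lambda>t. exp (- A t) *\<^sub>R u1 t) has_vector_derivative
      (exp (- A t) *\<^sub>R (a t *\<^sub>R u1 t) + (exp (- A t) * - a t) *\<^sub>R u1 t)) (at t within {0..1})" if "t \<in> {0..1}" for t
    by (intro has_vector_derivative_scaleR u1 that DERIV_chain2[OF DERIV_exp] DERIV_minus A)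
  moreover have "exp (- A t) *\<^sub>R (a t *\<^sub>R u1 t) + (exp (- A t) * - a t) *\<^sub>R u1 t = 0" for t
    by simp
  ultimately have "((\<lambda>t. exp (- A t) *\<^sub>R u1 t) has_vector_derivative 0) (at t within {0..1})" if "t \<in> {0..1}" for t
    using that by metis
  from const[OF this] have v: "exp (- A t) *\<^sub>R u1 t = v" if "t \<in> {0..1}" for t
    using that by (simp add: A_def v_def)
  have u1_eq: "u1 t = exp (A t) *\<^sub>R v" if "t \<in> {0..1}" for t
    using v[OF that, symmetric] by (simp add: exp_minus)
  have "continuous_on {0..1} A"
    unfolding continuous_on_eq_continuous_within by (intro ballI DERIV_continuous[OF A])
  then have E: "continuous_on {0..1} (\<lambda>t. exp (A t))" by (intro continuous_intros)
  define f where "f = (\<lambda>t. integral {0..t} (\<lambda>t. exp (A t)))"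
  have f: "(f has_real_derivative exp (A t)) (at t within {0..1})" if "t \<in> {0..1}" for t
    unfolding f_def has_real_derivative_iff_has_vector_derivative
    by (rule integral_has_vector_derivative[OF E that])
  have f0: "f 0 = 0" by (simp add: f_def)
  have "((\<lambda>t. u t - f t *\<^sub>R v) has_vector_derivative (u1 t - (f t *\<^sub>R 0 + exp (A t) *\<^sub>R v))) (at t within {0..1})"
    if "t \<in> {0..1}" for t
    by (intro has_vector_derivative_diff has_vector_derivative_scaleR u f that has_vector_derivative_const)
  then have "((\<lambda>t. u t - f t *\<^sub>R v) has_vector_derivative 0) (at t within {0..1})" if "t \<in> {0..1}" for t
    using u1_eq that by auto
  from const[OF this] have u_eq: "u t = u 0 + f t *\<^sub>R v" if "t \<in> {0..1}" for t
    using that by (metis (no_types, lifting) add.commute diff_add_cancel diff_zero f0 scaleR_zero_left)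
  have f_cont: "continuous_on {0..1} f"
    unfolding continuous_on_eq_continuous_within by (intro ballI DERIV_continuous[OF f])
  have f_mono: "f s < f t" if "0 \<le> s" "s < t" "t \<le> 1" for s t
  proof (rule DERIV_pos_imp_increasing_open[OF that(2)])
    show "\<exists>y. (f has_real_derivative y) (at x) \<and> 0 < y" if x: "s < x" "x < t" for x
    proof -
      have "at x within {0..1} = at x"
        by (rule at_within_interior) (use x \<open>0 \<le> s\<close> \<open>t \<le> 1\<close> in simp)
      then show ?thesis using f[of x] x \<open>0 \<le> s\<close> \<open>t \<le> 1\<close> by force
    qed
    show "continuous_on {s..t} f"
      using f_cont that by (rule_tac continuous_on_subset) auto
  qed
  have "f ` {0..1} = {0..f 1}"
  proof
    show "f ` {0..1} \<subseteq> {0..f 1}"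
      using f_mono f0 by (force simp: less_eq_real_def)
    show "{0..f 1} \<subseteq> f ` {0..1}"
      using IVT'[of f 0 _ 1] f_cont f0 by (force simp: image_iff)
  qed
  moreover have "f 1 > 0" using f_mono[of 0 1] f0 by simp
  moreover have "u ` {0..1} = (\<lambda>r. u 0 + r *\<^sub>R v) ` f ` {0..1}"
    unfolding image_image by (intro image_cong refl u_eq)
  moreover have "{0..f 1} = (\<lambda>s. s * f 1) ` {0..1}"
    using \<open>f 1 > 0\<close> by (simp add: image_mult_atLeastAtMost_if')
  ultimately have "u ` {0..1} = (\<lambda>r. u 0 + r *\<^sub>R v) ` (\<lambda>s. s * f 1) ` {0..1}"
    by simp
  also have "\<dots> = (\<lambda>s. u 0 + s *\<^sub>R (u 1 - u 0)) ` {0..1}"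
    unfolding image_image by (intro image_cong refl) (simp add: u_eq[of 1])
  also have "\<dots> = closed_segment (u 0) (u 1)"
    unfolding closed_segment_image_interval by (intro image_cong refl) (simp add: algebra_simps)
  finally show ?thesis .
qed

section \<open>The homogeneous extension\<close>

lemma sum_Basis_vec:
  fixes f :: "real ^ 'n::finite \<Rightarrow> 'a::comm_monoid_add"
  shows "(\<Sum>b\<in>Basis. f b) = (\<Sum>i\<in>UNIV. f (axis i (1::real)))"
proof -
  have Basis: "(Basis :: (real ^ 'n) set) = range (\<lambda>i. axis i 1)" by (auto simp: Basis_vec_def)
  have inj: "inj (\<lambda>i. axis i 1 :: real ^ 'n)" by (auto simp: inj_on_def axis_eq_axis)
  show ?thesis unfolding Basis sum.reindex[OF inj] by (simp add: o_def)
qed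

lemma Cinf_on_vec_lambda:
  fixes f :: "'a::euclidean_space \<Rightarrow> 'n::finite \<Rightarrow> real"
  assumes "open U" "\<And>i. Cinf_on U (\<lambda>x. f x i)"
  shows "Cinf_on U (\<lambda>x. \<chi> i. f x i)"
proof -
  have "Cinf_on U (\<lambda>x. \<Sum>i\<in>UNIV. f x i *\<^sub>R axis i 1)"
    using assms by (intro Cinf_on_sum Cinf_on_scaleR Cinf_on_const)
  then show ?thesis
    by (rule Cinf_on_cong) (simp add: vec_eq_iff axis_def if_distrib cong: if_cong)
qed

lemma has_real_derivative_along_line:
  assumes "(f has_derivative f') (at (p + t *\<^sub>R v))"
  shows "((\<lambda>t. f (p + t *\<^sub>R v)) has_real_derivative f' v) (at t)"
proof -
  have "((\<lambda>t. p + t *\<^sub>R v) has_derivative (\<lambda>h. h *\<^sub>R v)) (at t)"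
    by (auto intro!: derivative_eq_intros)
  then have "((\<lambda>t. f (p + t *\<^sub>R v)) has_derivative (\<lambda>h. f' (h *\<^sub>R v))) (at t)"
    by (rule has_derivative_compose) (rule assms)
  moreover have "f' (h *\<^sub>R v) = f' v * h" for h
    using linear_cmul[OF has_derivative_linear[OF assms], of h v] by simp
  ultimately show ?thesis by (simp add: has_field_derivative_def)
qed

lemma dir_deriv_eq: "(f has_derivative f') (at p) \<Longrightarrow> dir_deriv f p v = f' v"
  unfolding dir_deriv_def
  by (rule DERIV_imp_deriv, rule has_real_derivative_along_line) simp

definition orthant :: "(real ^ 'n::finite) set" where
  "orthant = {z. \<forall>i. z $ i > 0}"

definition coord_sum :: "real ^ 'n::finite \<Rightarrow> real" where
  "coord_sum z = (\<Sum>i\<in>UNIV. z $ i)"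

lemma open_orthant: "open (orthant :: (real ^ 'n::finite) set)"
proof -
  have "orthant = (\<Inter>i\<in>UNIV. {z :: real ^ 'n. 0 < z $ i})" by (auto simp: orthant_def)
  also have "open \<dots>"
    by (intro open_INT finite ballI open_Collect_less continuous_intros)
  finally show ?thesis .
qed

lemma bounded_linear_coord_sum: "bounded_linear coord_sum"
  unfolding coord_sum_def by (intro bounded_linear_sum bounded_linear_vec_nth)

lemmas coord_sum_simps = linear_add[OF bounded_linear.linear[OF bounded_linear_coord_sum]]
  linear_diff[OF bounded_linear.linear[OF bounded_linear_coord_sum]]
  linear_cmul[OF bounded_linear.linear[OF bounded_linear_coord_sum]]

lemma coord_sum_axis: "coord_sum (axis i (1::real)) = 1"
  by (simp add: coord_sum_def axis_def)

lemma coord_sum_pos: "z \<in> orthant \<Longrightarrow> coord_sum z > 0"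
  unfolding coord_sum_def orthant_def by (auto intro!: sum_pos)

lemma open_simplex_iff: "p \<in> open_simplex \<longleftrightarrow> p \<in> orthant \<and> coord_sum p = 1"
  by (auto simp: open_simplex_def orthant_def coord_sum_def)

lemma eventually_in_open_simplex:
  assumes "p \<in> open_simplex" "coord_sum v = 0"
  shows "\<forall>\<^sub>F t in nhds 0. p + t *\<^sub>R v \<in> open_simplex"
proof -
  have "((\<lambda>t::real. p + t *\<^sub>R v) \<longlongrightarrow> p + 0 *\<^sub>R v) (nhds 0)"
    by (intro tendsto_intros filterlim_ident)
  then have "\<forall>\<^sub>F t in nhds 0. p + t *\<^sub>R v \<in> orthant"
    by (rule topological_tendstoD[OF _ open_orthant]) (use assms in \<open>simp add: open_simplex_iff\<close>)
  then show ?thesis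
    by eventually_elim (use assms in \<open>simp add: open_simplex_iff coord_sum_simps\<close>)
qed

text \<open>
  Along tangent directions only values on the simplex matter, so \<open>\<phi>\<close>, which is arbitrary off the
  simplex, may be replaced by any smooth extension.
\<close>

lemma dir_deriv_cong_simplex:
  assumes "p \<in> open_simplex" "coord_sum v = 0" "\<And>q. q \<in> open_simplex \<Longrightarrow> f q = g q"
  shows "dir_deriv f p v = dir_deriv g p v"
  unfolding dir_deriv_def
  by (rule deriv_cong_ev[OF eventually_mono[OF eventually_in_open_simplex[OF assms(1,2)]] refl])
    (rule assms(3))

text \<open>
  The extension of \<open>exp \<circ> \<phi>\<close> that is homogeneous of degree one.
\<close>

definition hom_ext :: "(real ^ 'n::finite \<Rightarrow> real) \<Rightarrow> real ^ 'n \<Rightarrow> real" where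
  "hom_ext \<phi> z = coord_sum z * exp (\<phi> (inverse (coord_sum z) *\<^sub>R z))"

lemma hom_ext_simplex: "p \<in> open_simplex \<Longrightarrow> hom_ext \<phi> p = exp (\<phi> p)"
  by (simp add: hom_ext_def open_simplex_iff)

lemma hom_ext_pos: "z \<in> orthant \<Longrightarrow> hom_ext \<phi> z > 0"
  by (simp add: hom_ext_def coord_sum_pos)

lemma hom_ext_homogeneous: "c > 0 \<Longrightarrow> hom_ext \<phi> (c *\<^sub>R z) = c * hom_ext \<phi> z"
proof -
  assume "c > 0"
  then have "inverse (c * coord_sum z) * c = inverse (coord_sum z)"
    by (simp add: field_simps)
  then have "inverse (coord_sum (c *\<^sub>R z)) *\<^sub>R (c *\<^sub>R z) = inverse (coord_sum z) *\<^sub>R z"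
    by (simp only: coord_sum_simps scaleR_scaleR real_scaleR_def)
  then show ?thesis
    by (simp only: hom_ext_def) (simp only: coord_sum_simps real_scaleR_def mult.assoc)
qed

text \<open>
  Near each point of the orthant, \<open>\<phi>\<close> may be replaced by a local smooth extension, because the
  projection \<open>\<rho>\<close> maps the orthant smoothly into the simplex.
\<close>

lemma Cinf_on_hom_ext:
  assumes "smooth_on open_simplex \<phi>"
  shows "Cinf_on orthant (hom_ext \<phi>)"
proof (rule Cinf_on_local[OF open_orthant])
  fix z0 :: "real ^ 'a" assume z0: "z0 \<in> orthant"
  define \<rho> where "\<rho> = (\<lambda>z :: real ^ 'a. inverse (coord_sum z) *\<^sub>R z)"
  have coord_sum: "Cinf_on orthant (coord_sum :: real ^ 'a \<Rightarrow> real)"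
    by (simp add: Cinf_on_def open_orthant Ck_on_bounded_linear bounded_linear_coord_sum)
  have \<rho>: "Cinf_on orthant \<rho>" unfolding \<rho>_def
    by (intro Cinf_on_scaleR Cinf_on_inverse coord_sum Cinf_on_id open_orthant coord_sum_pos)
  have \<rho>_in: "\<rho> z \<in> open_simplex" if "z \<in> orthant" for z
    using that coord_sum_pos[OF that] by (auto simp: open_simplex_iff \<rho>_def coord_sum_simps orthant_def)
  obtain N F where N: "\<rho> z0 \<in> N" "Cinf_on N F" "\<And>y. y \<in> N \<Longrightarrow> y \<in> open_simplex \<Longrightarrow> F y = \<phi> y"
    by (rule smooth_onE[OF assms \<rho>_in[OF z0]]) (rule that)
  define M where "M = orthant \<inter> \<rho> -` N"
  have "open M" unfolding M_def
    by (rule continuous_open_preimage[OF Cinf_on_continuous[OF \<rho>] open_orthant Cinf_on_open[OF N(2)]])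
  have sub: "Cinf_on M f" if "Cinf_on orthant f" for f :: "real ^ 'a \<Rightarrow> 'b::euclidean_space"
    using that \<open>open M\<close> unfolding Cinf_on_def M_def by (auto intro: Ck_on_subset)
  have "Cinf_on M (\<lambda>z. coord_sum z * exp (F (\<rho> z)))"
    by (intro Cinf_on_mult Cinf_on_exp sub[OF coord_sum] Cinf_on_compose[OF N(2) sub[OF \<rho>]])
      (simp add: M_def)
  then have "Cinf_on M (hom_ext \<phi>)"
    by (rule Cinf_on_cong) (use N(3) \<rho>_in in \<open>simp add: M_def hom_ext_def \<rho>_def\<close>)
  then show "\<exists>N. z0 \<in> N \<and> Cinf_on N (hom_ext \<phi>)"
    using z0 N(1) by (intro exI[of _ M]) (simp add: M_def)
qed

locale strictly_exp_concave =
  fixes \<phi> :: "real ^ ('m::finite option) \<Rightarrow> real"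
  assumes smooth: "smooth_on open_simplex \<phi>"
    and neg_def: "\<And>p. p \<in> open_simplex \<Longrightarrow> hessian_neg_def_at (\<lambda>q. exp (\<phi> q)) p"
begin

definition \<Psi> where "\<Psi> = hom_ext \<phi>"

definition grad where "grad z = (\<chi> i. D \<Psi> z (axis i 1))"

lemma \<Psi>_Cinf: "Cinf_on orthant \<Psi>"
  unfolding \<Psi>_def by (rule Cinf_on_hom_ext[OF smooth])

lemma grad_Cinf: "Cinf_on orthant grad"
  unfolding grad_def by (intro Cinf_on_vec_lambda open_orthant Cinf_on_D \<Psi>_Cinf)

lemma D_\<Psi>:
  assumes "z \<in> orthant" shows "D \<Psi> z v = grad z \<bullet> v"
proof -
  have "D \<Psi> z v = (\<Sum>i\<in>UNIV. (v \<bullet> axis i 1) *\<^sub>R D \<Psi> z (axis i 1))"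
    using D_expand[OF Cinf_on_differentiable[OF \<Psi>_Cinf assms], of v] unfolding sum_Basis_vec .
  also have "\<dots> = grad z \<bullet> v"
    unfolding inner_axis by (simp add: grad_def inner_vec_def mult.commute)
  finally show ?thesis .
qed

lemma \<Psi>_has_derivative: "z \<in> orthant \<Longrightarrow> (\<Psi> has_derivative (\<lambda>v. grad z \<bullet> v)) (at z)"
  using Cinf_on_has_derivative[OF \<Psi>_Cinf, of z] ext[of "D \<Psi> z" "\<lambda>v. grad z \<bullet> v", OF D_\<Psi>] by simp

lemma grad_has_derivative: "z \<in> orthant \<Longrightarrow> (grad has_derivative D grad z) (at z)"
  by (rule Cinf_on_has_derivative[OF grad_Cinf])

lemma grad_inner_has_derivative:
  assumes "z \<in> orthant"
  shows "((\<lambda>x. grad x \<bullet> w) has_derivative (\<lambda>v. D grad z v \<bullet> w)) (at z)"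
  by (rule has_derivative_inner_left[OF grad_has_derivative[OF assms]])

text \<open>
  Euler's relation for functions that are homogeneous of degree one.
\<close>

lemma grad_inner_self: "z \<in> orthant \<Longrightarrow> grad z \<bullet> z = \<Psi> z"
proof -
  assume z: "z \<in> orthant"
  have "((\<lambda>t. \<Psi> (z + t *\<^sub>R z)) has_real_derivative grad z \<bullet> z) (at 0)"
    by (rule has_real_derivative_along_line) (simp add: \<Psi>_has_derivative z)
  moreover have "((\<lambda>t. \<Psi> (z + t *\<^sub>R z)) has_real_derivative \<Psi> z) (at 0)"
  proof (rule DERIV_cong_ev[THEN iffD1, OF refl _ refl])
    have "\<forall>\<^sub>F t::real in nhds 0. t \<in> {-1<..}"
      by (rule eventually_nhds_in_open) auto
    then show "\<forall>\<^sub>F t in nhds 0. (1 + t) * \<Psi> z = \<Psi> (z + t *\<^sub>R z)"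
    proof eventually_elim
      case (elim t)
      then show ?case
        using hom_ext_homogeneous[of "1 + t" \<phi> z] by (simp add: \<Psi>_def scaleR_add_left)
    qed
    show "((\<lambda>t. (1 + t) * \<Psi> z) has_real_derivative \<Psi> z) (at 0)"
      by (auto intro!: derivative_eq_intros)
  qed
  ultimately show ?thesis by (rule DERIV_unique)
qed

text \<open>
  Differentiating \<open>grad z \<bullet> z = \<Psi> z\<close> gives \<open>grad z \<bullet> v\<close> on both sides, plus this term on the left.
\<close>

lemma D_grad_inner_self:
  assumes "z \<in> orthant" shows "D grad z v \<bullet> z = 0"
proof -
  have "((\<lambda>x. grad x \<bullet> x) has_derivative (\<lambda>v. grad z \<bullet> v + D grad z v \<bullet> z)) (at z)"
    by (intro has_derivative_inner has_derivative_ident grad_has_derivative assms)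
  then have "(\<Psi> has_derivative (\<lambda>v. grad z \<bullet> v + D grad z v \<bullet> z)) (at z)"
    by (rule has_derivative_transform_within_open[OF _ open_orthant assms]) (rule grad_inner_self)
  then have "(\<lambda>v. grad z \<bullet> v + D grad z v \<bullet> z) = (\<lambda>v. grad z \<bullet> v)"
    by (rule has_derivative_unique[OF _ \<Psi>_has_derivative[OF assms]])
  then show ?thesis by (simp add: fun_eq_iff)
qed

lemma D_grad_symmetric:
  assumes "z \<in> orthant" shows "D grad z v \<bullet> w = D grad z w \<bullet> v"
proof -
  have "D (\<lambda>x. D \<Psi> x w) z v = D grad z v \<bullet> w" for v w
  proof -
    have "((\<lambda>x. D \<Psi> x w) has_derivative (\<lambda>v. D grad z v \<bullet> w)) (at z)"
      by (rule has_derivative_transform_within_open[OF grad_inner_has_derivative[OF assms] open_orthant assms])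
        (simp add: D_\<Psi>)
    from D_eqI[OF this] show ?thesis by simp
  qed
  then show ?thesis using D_D_commute[OF \<Psi>_Cinf assms, of w v] by simp
qed

lemma \<Psi>_simplex: "p \<in> open_simplex \<Longrightarrow> \<Psi> p = exp (\<phi> p)"
  by (simp add: \<Psi>_def hom_ext_simplex)

lemma D_grad_neg_def:
  assumes p: "p \<in> open_simplex" and v: "coord_sum v = 0" "v \<noteq> 0"
  shows "D grad p v \<bullet> v < 0"
proof -
  have "dir_deriv (\<lambda>q. exp (\<phi> q)) q v = grad q \<bullet> v" if "q \<in> open_simplex" for q
  proof -
    have "dir_deriv (\<lambda>q. exp (\<phi> q)) q v = dir_deriv \<Psi> q v"
      by (rule dir_deriv_cong_simplex[OF that v(1)]) (simp add: \<Psi>_simplex)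
    also have "\<dots> = grad q \<bullet> v"
      using that by (intro dir_deriv_eq \<Psi>_has_derivative) (simp add: open_simplex_iff)
    finally show ?thesis .
  qed
  then have "hessian (\<lambda>q. exp (\<phi> q)) p v v = dir_deriv (\<lambda>q. grad q \<bullet> v) p v"
    unfolding hessian_def by (intro dir_deriv_cong_simplex[OF p v(1)])
  also have "\<dots> = D grad p v \<bullet> v"
    using p by (intro dir_deriv_eq grad_inner_has_derivative) (simp add: open_simplex_iff)
  finally have "D grad p v \<bullet> v = hessian (\<lambda>q. exp (\<phi> q)) p v v" ..
  then show ?thesis
    using neg_def[OF p] v by (simp add: hessian_neg_def_at_def coord_sum_def)
qed

lemma dir_deriv_potential:
  assumes p: "p \<in> open_simplex" and v: "coord_sum v = 0"
  shows "dir_deriv \<phi> p v = grad p \<bullet> v / \<Psi> p"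
proof -
  have "dir_deriv \<phi> p v = dir_deriv (\<lambda>q. ln (\<Psi> q)) p v"
    by (rule dir_deriv_cong_simplex[OF p v]) (simp add: \<Psi>_simplex)
  also have "\<dots> = grad p \<bullet> v / \<Psi> p"
  proof (rule dir_deriv_eq)
    have "\<Psi> p > 0" by (simp add: \<Psi>_simplex p)
    then show "((\<lambda>q. ln (\<Psi> q)) has_derivative (\<lambda>v. grad p \<bullet> v / \<Psi> p)) (at p)"
      using p by (auto intro!: derivative_eq_intros \<Psi>_has_derivative simp: open_simplex_iff field_simps)
  qed
  finally show ?thesis .
qed

lemma one_plus_dir_deriv:
  assumes p: "p \<in> open_simplex" and q: "coord_sum q = 1"
  shows "1 + dir_deriv \<phi> p (q - p) = grad p \<bullet> q / \<Psi> p"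
proof -
  have "grad p \<bullet> p = \<Psi> p" "\<Psi> p > 0" using p by (simp_all add: grad_inner_self open_simplex_iff \<Psi>_def hom_ext_pos)
  moreover have "coord_sum (q - p) = 0" using p q by (simp add: coord_sum_simps open_simplex_iff)
  ultimately show ?thesis
    using dir_deriv_potential[OF p, of "q - p"] by (simp add: inner_diff_right field_simps)
qed

text \<open>
  Let \<open>f\<close> be the restriction of \<open>\<Psi>\<close> to the segment from \<open>p\<close> to the vertex \<open>axis i 1\<close>. By Euler's
  relation the claim is \<open>f 0 + f' 0 > 0\<close>: the tangent line of \<open>f\<close> at \<open>0\<close> is positive at the vertex.
  Since \<open>f\<close> is positive before the vertex, following the tangents at \<open>0\<close> and at \<open>1/2\<close> leads to a
  nonnegative value at \<open>1\<close>; strict concavity makes the single tangent at \<open>0\<close> end strictly higher.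
  Mere concavity would not suffice, as \<open>f t = 1 - t\<close> shows.
\<close>

lemma grad_nth_pos:
  assumes p: "p \<in> open_simplex"
  shows "grad p $ i > 0"
proof -
  define d where "d = axis i 1 - p"
  have d: "coord_sum d = 0" using p by (simp add: d_def coord_sum_simps coord_sum_axis open_simplex_iff)
  have "d \<noteq> 0"
  proof
    assume "d = 0"
    then have eq: "p = axis i 1" by (simp add: d_def)
    obtain j where "j \<noteq> i" by (metis not_None_eq option.distinct(1) ex_in_conv UNIV_I)
    then have "p $ j = 0" by (simp add: eq axis_def)
    then show False using p by (simp add: open_simplex_def less_le)
  qed
  have in_simplex: "p + t *\<^sub>R d \<in> open_simplex" if "0 \<le> t" "t < 1" for t
  proof -
    have "(p + t *\<^sub>R d) $ j > 0" for j
    proof -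
      have "(p + t *\<^sub>R d) $ j = (1 - t) * p $ j + t * axis i 1 $ j" by (simp add: d_def algebra_simps)
      moreover have "(1 - t) * p $ j > 0" using that p by (simp add: open_simplex_def)
      moreover have "t * axis i 1 $ j \<ge> 0" using that by (simp add: axis_def)
      ultimately show ?thesis by linarith
    qed
    then show ?thesis using p d by (simp add: open_simplex_iff orthant_def coord_sum_simps)
  qed
  define f where "f = (\<lambda>t. \<Psi> (p + t *\<^sub>R d))"
  define f' where "f' = (\<lambda>t. grad (p + t *\<^sub>R d) \<bullet> d)"
  have f: "(f has_real_derivative f' t) (at t)" if "0 \<le> t" "t < 1" for t
    unfolding f_def f'_def
    by (rule has_real_derivative_along_line[OF \<Psi>_has_derivative])
      (use in_simplex[OF that] in \<open>simp add: open_simplex_iff\<close>)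
  have f': "(f' has_real_derivative D grad (p + t *\<^sub>R d) d \<bullet> d) (at t)" if "0 \<le> t" "t < 1" for t
    unfolding f'_def
    by (rule has_real_derivative_along_line[OF grad_inner_has_derivative])
      (use in_simplex[OF that] in \<open>simp add: open_simplex_iff\<close>)
  have decr: "f' t < f' s" if "0 \<le> s" "s < t" "t < 1" for s t
  proof (rule DERIV_neg_imp_decreasing[OF that(2)])
    fix x assume "s \<le> x" "x \<le> t"
    then have "0 \<le> x" "x < 1" using that by auto
    then show "\<exists>y. (f' has_real_derivative y) (at x) \<and> y < 0"
      using f' D_grad_neg_def[OF in_simplex d \<open>d \<noteq> 0\<close>] by blast
  qed
  have tangent: "f t - f s \<le> (t - s) * f' s" if "0 \<le> s" "s < t" "t < 1" for s t
  proof -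
    have "\<exists>x. s < x \<and> x < t \<and> f t - f s = (t - s) * f' x"
      by (rule MVT2[OF \<open>s < t\<close>]) (use f that in auto)
    then obtain x where "s < x" "x < t" "f t - f s = (t - s) * f' x" by blast
    moreover from this have "f' x \<le> f' s" using decr[of s x] that by simp
    ultimately show ?thesis using that by (simp add: mult_left_mono)
  qed
  have "\<forall>\<^sub>F s in at_left 1. s \<in> {1/2<..<1::real}"
    by (rule eventually_at_left_real) simp
  then have ev: "\<forall>\<^sub>F s in at_left 1. 0 \<le> f 0 + f' 0 / 2 + (s - 1/2) * f' (1/2)"
  proof eventually_elim
    case (elim s)
    then have "f s > 0" using in_simplex[of s] by (simp add: f_def \<Psi>_simplex)
    moreover have "f s - f (1/2) \<le> (s - 1/2) * f' (1/2)" using elim by (intro tangent) auto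
    moreover have "f (1/2) - f 0 \<le> f' 0 / 2" using tangent[of 0 "1/2"] by simp
    moreover define X where "X = (s - 1/2) * f' (1/2)"
    ultimately show ?case by (fold X_def) argo
  qed
  have "((\<lambda>s. f 0 + f' 0 / 2 + (s - 1/2) * f' (1/2)) \<longlongrightarrow> f 0 + f' 0 / 2 + (1 - 1/2) * f' (1/2)) (at_left 1)"
    by (intro tendsto_intros)
  from tendsto_lowerbound[OF this ev] have "0 \<le> f 0 + f' 0 / 2 + (1 - 1/2) * f' (1/2)" by simp
  with decr[of 0 "1/2"] have "0 < f 0 + f' 0" by simp
  also have "f 0 + f' 0 = grad p \<bullet> axis i 1"
    using p grad_inner_self[of p] by (simp add: f_def f'_def d_def inner_diff_right open_simplex_iff)
  finally show ?thesis by (simp add: inner_axis)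
qed

lemma grad_inner_pos:
  assumes "p \<in> open_simplex" "q \<in> open_simplex"
  shows "grad p \<bullet> q > 0"
  using assms grad_nth_pos[OF assms(1)]
  by (auto simp: inner_vec_def open_simplex_def intro!: sum_pos)

text \<open>
  The tangent plane of \<open>exp \<circ> \<phi>\<close> at \<open>p\<close> is the restriction of the linear form \<open>grad p\<close>, and
  \<open>1 + \<nabla>\<phi>(p) \<cdot> (q - p)\<close> is its value at \<open>q\<close> divided by \<open>exp (\<phi> p)\<close>.
\<close>

lemma L_div_eq:
  assumes "p \<in> open_simplex" "q \<in> open_simplex"
  shows "L_div \<phi> q p = ln (grad p \<bullet> q) - \<phi> q"
proof -
  have "1 + dir_deriv \<phi> p (q - p) = grad p \<bullet> q / \<Psi> p"
    using assms by (intro one_plus_dir_deriv) (auto simp: open_simplex_iff)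
  then show ?thesis
    using grad_inner_pos[OF assms] by (simp add: L_div_def ln_div \<Psi>_simplex assms)
qed

text \<open>
  The portfolio weights are \<open>p\<^sub>i grad\<^sub>i / \<Psi>\<close>, so the factors \<open>p\<^sub>i / p\<^sub>n\<close> of the primal coordinate cancel
  and \<open>exp (- \<phi>\<^sub>i)\<close> is the ratio of the \<open>i\<close>-th to the last coordinate of the gradient.
\<close>

lemma dual_euclid_eq:
  assumes p: "p \<in> open_simplex"
  shows "dual_euclid \<phi> p = inverse (coord_sum (grad p)) *\<^sub>R grad p"
proof -
  have g: "grad p $ i > 0" for i by (rule grad_nth_pos[OF p])
  have "\<Psi> p > 0" by (simp add: \<Psi>_simplex p)
  have "portfolio \<phi> p $ i = p $ i * (grad p $ i / \<Psi> p)" for i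
    using one_plus_dir_deriv[OF p, of "axis i 1"] by (simp add: portfolio_def coord_sum_axis inner_axis)
  then have ratio: "portfolio \<phi> p $ i / portfolio \<phi> p $ None = (p $ i / p $ None) * (grad p $ i / grad p $ None)" for i
    using \<open>\<Psi> p > 0\<close> by simp
  have p_pos: "p $ i > 0" for i using p by (simp add: open_simplex_def)
  have "exp (- dual_coord_ext \<phi> p i) = grad p $ i / grad p $ None" for i
  proof (cases i)
    case None
    then show ?thesis using g[of None] by (simp add: dual_coord_ext_def)
  next
    case (Some j)
    have "dual_coord_ext \<phi> p i = - ln (grad p $ i / grad p $ None)"
      using Some g p_pos ln_mult_pos[of "p $ i / p $ None" "grad p $ i / grad p $ None"]
      by (simp add: dual_coord_ext_def dual_coord_def primal_coord_def ratio del: times_divide_times_eq)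
    then show ?thesis using g by simp
  qed
  then have "dual_euclid \<phi> p $ i = (grad p $ i / grad p $ None) / (coord_sum (grad p) / grad p $ None)" for i
    by (simp add: dual_euclid_def coord_sum_def sum_divide_distrib)
  then show ?thesis
    using g[of None] by (simp add: vec_eq_iff field_simps)
qed

end

section \<open>Charts and the geodesic equation\<close>

lemma partial_eq: "(f has_derivative f') (at x) \<Longrightarrow> partial i f x = f' (axis i 1)"
  unfolding partial_def by (rule dir_deriv_eq)

lemma partial_cong:
  assumes "open V" "x \<in> V" "\<And>y. y \<in> V \<Longrightarrow> f y = g y"
  shows "partial i f x = partial i g x"
proof -
  have "((\<lambda>t::real. x + t *\<^sub>R axis i 1) \<longlongrightarrow> x + 0 *\<^sub>R axis i 1) (nhds 0)"
    by (intro tendsto_intros filterlim_ident)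
  then have "\<forall>\<^sub>F t in nhds 0. x + t *\<^sub>R axis i 1 \<in> V"
    by (rule topological_tendstoD[OF _ assms(1)]) (simp add: assms(2))
  then show ?thesis
    unfolding partial_def dir_deriv_def
    by (intro deriv_cong_ev refl) (rule eventually_mono, assumption, rule assms(3))
qed

lemma partial_Cinf: "Cinf_on V f \<Longrightarrow> x \<in> V \<Longrightarrow> partial i f x = D f x (axis i 1)"
  by (rule partial_eq[OF Cinf_on_has_derivative])

lemma partial_partial_Cinf:
  assumes "Cinf_on V f" "x \<in> V"
  shows "partial i (\<lambda>a. partial j f a) x = D (\<lambda>a. D f a (axis j 1)) x (axis i 1)"
  by (subst partial_cong[OF Cinf_on_open[OF assms(1)] assms(2) partial_Cinf[OF assms(1)]], assumption)
    (rule partial_Cinf[OF Cinf_on_D[OF assms(1)] assms(2)])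

lemma twice_deriv_at_compose_partial:
  assumes "Cinf_on V f" "twice_deriv_at c c1 c2 t" "c t \<in> V"
  shows "\<exists>f1. twice_deriv_at (\<lambda>s. f (c s)) f1
    ((\<Sum>i\<in>UNIV. \<Sum>j\<in>UNIV. c1 t $ i * c1 t $ j * partial i (\<lambda>a. partial j f a) (c t))
      + (\<Sum>i\<in>UNIV. c2 $ i * partial i f (c t))) t"
  using twice_deriv_at_compose[OF assms]
  by (auto simp: sum_Basis_vec inner_axis partial_partial_Cinf[OF assms(1,3)] partial_Cinf[OF assms(1,3)] mult.assoc)

lemma twice_deriv_at_const: "t \<in> {0..1} \<Longrightarrow> twice_deriv_at (\<lambda>s. c) (\<lambda>s. 0) 0 t"
  by (rule twice_deriv_atI[OF _ open_UNIV]) auto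

text \<open>
  Multiplication by \<open>g\<close> from the right cancels the inverse and leaves \<open>a\<close> paired with the first slot of
  \<open>g\<close>. For the dual connection the slot of the moving point is the second one; there the symmetry of the
  metric is needed.
\<close>

lemma lower_raised_index:
  fixes g :: "real ^ 'm::finite ^ 'm"
  assumes inv: "invertible g"
    and eq: "\<And>k. a $ k + (\<Sum>i\<in>UNIV. \<Sum>j\<in>UNIV. raise_last g \<Gamma> i j k * v $ i * v $ j) = 0"
  shows "(\<Sum>k\<in>UNIV. a $ k * g $ k $ m) + (\<Sum>i\<in>UNIV. \<Sum>j\<in>UNIV. \<Gamma> i j m * v $ i * v $ j) = 0"
proof -
  define b :: "real ^ 'm" where "b = (\<chi> m. \<Sum>i\<in>UNIV. \<Sum>j\<in>UNIV. \<Gamma> i j m * v $ i * v $ j)"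
  have "(\<Sum>i\<in>UNIV. \<Sum>j\<in>UNIV. raise_last g \<Gamma> i j k * v $ i * v $ j) = (b v* matrix_inv g) $ k" for k
  proof -
    have "(\<Sum>i\<in>UNIV. \<Sum>j\<in>UNIV. raise_last g \<Gamma> i j k * v $ i * v $ j)
        = (\<Sum>i\<in>UNIV. \<Sum>j\<in>UNIV. \<Sum>m\<in>UNIV. \<Gamma> i j m * v $ i * v $ j * matrix_inv g $ m $ k)"
      by (simp add: raise_last_def sum_distrib_left sum_distrib_right mult_ac)
    also have "\<dots> = (\<Sum>i\<in>UNIV. \<Sum>m\<in>UNIV. \<Sum>j\<in>UNIV. \<Gamma> i j m * v $ i * v $ j * matrix_inv g $ m $ k)"
      by (intro sum.cong refl sum.swap)
    also have "\<dots> = (\<Sum>m\<in>UNIV. \<Sum>i\<in>UNIV. \<Sum>j\<in>UNIV. \<Gamma> i j m * v $ i * v $ j * matrix_inv g $ m $ k)"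
      by (rule sum.swap)
    also have "\<dots> = (b v* matrix_inv g) $ k"
      by (simp add: vector_matrix_mult_def b_def sum_distrib_left mult_ac)
    finally show ?thesis .
  qed
  then have "a = - (b v* matrix_inv g)"
    using eq by (simp add: vec_eq_iff eq_neg_iff_add_eq_0)
  then have "a v* g = - (b v* matrix_inv g v* g)"
    by (simp add: vector_matrix_mult_def vec_eq_iff sum_negf)
  also have "\<dots> = - b"
  proof -
    have "matrix_inv g ** g = mat 1"
      using someI_ex[OF inv[unfolded invertible_def]] by (simp add: matrix_inv_def)
    then show ?thesis by (simp add: vector_matrix_mul_assoc)
  qed
  finally have "(a v* g) $ m + b $ m = 0" by simp
  then show ?thesis by (simp add: vector_matrix_mult_def b_def mult.commute)
qed

locale chart = strictly_exp_concave \<phi>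
  for \<phi> :: "real ^ ('m::finite option) \<Rightarrow> real" +
  fixes U :: "(real ^ ('m option)) set" and \<xi> :: "real ^ ('m option) \<Rightarrow> real ^ 'm"
  assumes chart: "coord_system U \<xi>"
begin

definition P where "P = inv_into U \<xi>"
definition V where "V = \<xi> ` U"

lemma U_simplex: "p \<in> U \<Longrightarrow> p \<in> open_simplex"
  using chart openin_imp_subset unfolding coord_system_def by blast

lemma V_open: "open V"
  using chart by (simp add: coord_system_def V_def)

lemma P_Cinf: "Cinf_on V P"
  using chart by (intro smooth_on_open_imp_Cinf_on V_open) (simp add: coord_system_def V_def P_def)

lemma P_in_U: "a \<in> V \<Longrightarrow> P a \<in> U"
  by (simp add: P_def V_def inv_into_into)

lemma P_\<xi>: "p \<in> U \<Longrightarrow> P (\<xi> p) = p"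
  using chart by (simp add: P_def coord_system_def)

lemma \<xi>_P: "a \<in> V \<Longrightarrow> \<xi> (P a) = a"
  by (simp add: P_def V_def f_inv_into_f)

lemma \<xi>_in_V: "p \<in> U \<Longrightarrow> \<xi> p \<in> V"
  by (simp add: V_def)

lemma P_orthant: "a \<in> V \<Longrightarrow> P a \<in> orthant"
  using P_in_U U_simplex by (auto simp: open_simplex_iff)

lemma P_has_derivative: "x \<in> V \<Longrightarrow> (P has_derivative D P x) (at x)"
  by (rule Cinf_on_has_derivative[OF P_Cinf])

lemma \<xi>_extension:
  assumes "p \<in> U"
  obtains N \<Xi> where "open N" "p \<in> N" "Cinf_on N \<Xi>" "\<And>q. q \<in> N \<Longrightarrow> q \<in> open_simplex \<Longrightarrow> q \<in> U \<and> \<Xi> q = \<xi> q"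
proof -
  have "smooth_on U \<xi>" using chart by (simp add: coord_system_def)
  then obtain N \<Xi> where N: "p \<in> N" "Cinf_on N \<Xi>" "\<And>q. q \<in> N \<Longrightarrow> q \<in> U \<Longrightarrow> \<Xi> q = \<xi> q"
    by (rule smooth_onE[OF _ assms]) (rule that)
  obtain W where W: "open W" "U = open_simplex \<inter> W"
    using chart unfolding coord_system_def openin_open by blast
  have "Cinf_on (N \<inter> W) \<Xi>"
    using N(2) W(1) unfolding Cinf_on_def by (auto intro: Ck_on_subset)
  then show thesis
    by (intro that[of "N \<inter> W" \<Xi>] Cinf_on_open) (use N W assms in auto)
qed

lemma coord_sum_D_P:
  assumes "x \<in> V" shows "coord_sum (D P x w) = 0"
proof -
  have "((\<lambda>a. coord_sum (P a)) has_derivative (\<lambda>w. coord_sum (D P x w))) (at x)"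
    by (rule bounded_linear.has_derivative[OF bounded_linear_coord_sum P_has_derivative[OF assms]])
  then have "((\<lambda>a. 1) has_derivative (\<lambda>w. coord_sum (D P x w))) (at x)"
    by (rule has_derivative_transform_within_open[OF _ V_open assms])
      (use P_in_U U_simplex in \<open>simp add: open_simplex_iff\<close>)
  from has_derivative_unique[OF this has_derivative_const] show ?thesis by (rule fun_cong)
qed

text \<open>
  A straight line in the simplex through \<open>p\<close> is reproduced by \<open>P \<circ> \<xi>\<close>; differentiating this identity
  exhibits its direction \<open>z\<close> as a value of the derivative of \<open>P\<close>. Together with the next lemma it says that
  the coordinate vector fields at \<open>p\<close> form a basis of the tangent space.
\<close>

lemma D_P_surj:
  assumes p: "p \<in> U" and z: "coord_sum z = 0"
  shows "\<exists>w. z = D P (\<xi> p) w"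
proof -
  obtain N \<Xi> where N: "open N" "p \<in> N" "Cinf_on N \<Xi>" "\<And>q. q \<in> N \<Longrightarrow> q \<in> open_simplex \<Longrightarrow> q \<in> U \<and> \<Xi> q = \<xi> q"
    by (rule \<xi>_extension[OF p]) (rule that)
  have "((\<lambda>t::real. p + t *\<^sub>R z) \<longlongrightarrow> p + 0 *\<^sub>R z) (nhds 0)"
    by (intro tendsto_intros filterlim_ident)
  then have "\<forall>\<^sub>F t in nhds 0. p + t *\<^sub>R z \<in> N"
    by (rule topological_tendstoD[OF _ N(1)]) (simp add: N(2))
  then have "\<forall>\<^sub>F t in nhds 0. P (\<Xi> (p + t *\<^sub>R z)) = p + t *\<^sub>R z"
    using eventually_in_open_simplex[OF U_simplex[OF p] z]
    by eventually_elim (use N(4) P_\<xi> in auto)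
  then obtain M where M: "open M" "0 \<in> M" "\<And>t. t \<in> M \<Longrightarrow> P (\<Xi> (p + t *\<^sub>R z)) = p + t *\<^sub>R z"
    unfolding eventually_nhds by blast
  have "\<Xi> p = \<xi> p" using N(2,4) U_simplex[OF p] by simp
  have "((\<lambda>t. p + t *\<^sub>R z) has_derivative (\<lambda>h. h *\<^sub>R z)) (at 0)"
    by (auto intro!: derivative_eq_intros)
  moreover have "(\<Xi> has_derivative D \<Xi> p) (at (p + 0 *\<^sub>R z))"
    using Cinf_on_has_derivative[OF N(3,2)] by simp
  ultimately have "((\<lambda>t. \<Xi> (p + t *\<^sub>R z)) has_derivative (\<lambda>h. D \<Xi> p (h *\<^sub>R z))) (at 0)"
    by (rule has_derivative_compose)
  moreover have "(P has_derivative D P (\<xi> p)) (at (\<Xi> (p + 0 *\<^sub>R z)))"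
    using P_has_derivative[OF \<xi>_in_V[OF p]] \<open>\<Xi> p = \<xi> p\<close> by simp
  ultimately have "((\<lambda>t. P (\<Xi> (p + t *\<^sub>R z))) has_derivative (\<lambda>h. D P (\<xi> p) (D \<Xi> p (h *\<^sub>R z)))) (at 0)"
    by (rule has_derivative_compose)
  then have "((\<lambda>t. p + t *\<^sub>R z) has_derivative (\<lambda>h. D P (\<xi> p) (D \<Xi> p (h *\<^sub>R z)))) (at 0)"
    by (rule has_derivative_transform_within_open[OF _ M])
  moreover have "((\<lambda>t. p + t *\<^sub>R z) has_derivative (\<lambda>h. h *\<^sub>R z)) (at 0)"
    by (auto intro!: derivative_eq_intros)
  ultimately have "(\<lambda>h. D P (\<xi> p) (D \<Xi> p (h *\<^sub>R z))) = (\<lambda>h. h *\<^sub>R z)"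
    by (rule has_derivative_unique)
  from fun_cong[OF this, of 1] show ?thesis by (intro exI[of _ "D \<Xi> p z"]) simp
qed

lemma D_P_inj:
  assumes x: "x \<in> V" and w: "D P x w = 0" shows "w = 0"
proof -
  obtain N \<Xi> where N: "open N" "P x \<in> N" "Cinf_on N \<Xi>" "\<And>q. q \<in> N \<Longrightarrow> q \<in> open_simplex \<Longrightarrow> q \<in> U \<and> \<Xi> q = \<xi> q"
    by (rule \<xi>_extension[OF P_in_U[OF x]]) (rule that)
  have "open (V \<inter> P -` N)"
    by (rule continuous_open_preimage[OF Cinf_on_continuous[OF P_Cinf] V_open N(1)])
  have "((\<lambda>a. \<Xi> (P a)) has_derivative (\<lambda>w. D \<Xi> (P x) (D P x w))) (at x)"
    by (rule has_derivative_compose[OF P_has_derivative[OF x] Cinf_on_has_derivative[OF N(3,2)]])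
  then have "((\<lambda>a. a) has_derivative (\<lambda>w. D \<Xi> (P x) (D P x w))) (at x)"
    by (rule has_derivative_transform_within_open[OF _ \<open>open (V \<inter> P -` N)\<close>])
      (use x N(2,4) P_in_U U_simplex \<xi>_P in auto)
  from has_derivative_unique[OF this has_derivative_ident]
  have "D \<Xi> (P x) (D P x w) = w" by (rule fun_cong)
  moreover have "D \<Xi> (P x) 0 = 0"
    using linear_0[OF linear_frechet_derivative[OF Cinf_on_differentiable[OF N(3,2)]]] .
  ultimately show ?thesis using w by simp
qed

lemma D_P_expand: "x \<in> V \<Longrightarrow> D P x w = (\<Sum>i\<in>UNIV. w $ i *\<^sub>R D P x (axis i 1))"
  using D_expand[OF Cinf_on_differentiable[OF P_Cinf], of x w] unfolding sum_Basis_vec by (simp add: inner_axis)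

lemma orthogonal_tangentI:
  assumes "x \<in> V" "\<And>m. y \<bullet> D P x (axis m 1) = 0" "coord_sum v = 0"
  shows "y \<bullet> v = 0"
proof -
  obtain w where "v = D P x w" using D_P_surj[OF P_in_U[OF assms(1)] assms(3)] \<xi>_P[OF assms(1)] by auto
  then show ?thesis using assms(2) by (simp add: D_P_expand[OF assms(1), of w] inner_sum_right)
qed

lemma L_div_coord_eq:
  "a \<in> V \<Longrightarrow> b \<in> V \<Longrightarrow> L_div_coord \<phi> U \<xi> a b = ln (grad (P b) \<bullet> P a) - \<phi> (P a)"
  using P_in_U[THEN U_simplex] by (simp add: L_div_coord_def L_div_eq flip: P_def)

lemma grad_P_pos: "a \<in> V \<Longrightarrow> b \<in> V \<Longrightarrow> grad (P b) \<bullet> P a > 0"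
  by (intro grad_inner_pos P_in_U U_simplex)

lemma grad_P_Cinf: "Cinf_on V (\<lambda>b. grad (P b))"
  by (rule Cinf_on_compose[OF grad_Cinf P_Cinf P_orthant])

lemma D_grad_P: "x \<in> V \<Longrightarrow> D (\<lambda>b. grad (P b)) x = (\<lambda>w. D grad (P x) (D P x w))"
  by (rule D_eqI) (rule has_derivative_compose[OF P_has_derivative grad_has_derivative[OF P_orthant]])

text \<open>
  The part of \<open>T(a | b)\<close>, in coordinates, that depends on \<open>b\<close>.
\<close>

definition logpair where "logpair a b = ln (grad (P b) \<bullet> P a)"

lemma logpair_Cinf:
  assumes "a \<in> V" shows "Cinf_on V (logpair a)"
  unfolding logpair_def
  by (intro Cinf_on_ln Cinf_on_inner grad_P_Cinf Cinf_on_const V_open) (use assms grad_P_pos in auto)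

lemma partial_L_div_coord:
  assumes "a \<in> V" "b \<in> V"
  shows "partial k (L_div_coord \<phi> U \<xi> a) b = partial k (logpair a) b"
proof -
  have "partial k (L_div_coord \<phi> U \<xi> a) b = partial k (\<lambda>b. logpair a b - \<phi> (P a)) b"
    by (rule partial_cong[OF V_open assms(2)]) (simp add: L_div_coord_eq assms(1) logpair_def)
  also have "\<dots> = D (logpair a) b (axis k 1)"
    by (rule partial_eq[where f' = "D (logpair a) b"])
      (use has_derivative_diff[OF Cinf_on_has_derivative[OF logpair_Cinf[OF assms(1)] assms(2)] has_derivative_const] in simp)
  also have "\<dots> = partial k (logpair a) b"
    by (rule partial_Cinf[symmetric, OF logpair_Cinf]) fact+
  finally show ?thesis .
qed

lemma partial_logpair:
  assumes "a \<in> V" "b \<in> V"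
  shows "partial k (logpair a) b = (D (\<lambda>b. grad (P b)) b (axis k 1) \<bullet> P a) * inverse (grad (P b) \<bullet> P a)"
proof (rule partial_eq)
  show "(logpair a has_derivative (\<lambda>w. (D (\<lambda>b. grad (P b)) b w \<bullet> P a) * inverse (grad (P b) \<bullet> P a))) (at b)"
    unfolding logpair_def
    using grad_P_pos[OF assms] Cinf_on_has_derivative[OF grad_P_Cinf assms(2)]
    by (auto intro!: derivative_eq_intros simp: field_simps)
qed

lemma partial_partial_logpair:
  assumes "a \<in> V" "b \<in> V"
  shows "partial i (\<lambda>b. partial j (logpair a) b) b =
     (D (\<lambda>b. D (\<lambda>b. grad (P b)) b (axis j 1)) b (axis i 1) \<bullet> P a) * inverse (grad (P b) \<bullet> P a)
     + - ((D (\<lambda>b. grad (P b)) b (axis j 1) \<bullet> P a) * (D (\<lambda>b. grad (P b)) b (axis i 1) \<bullet> P a)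
        * (inverse (grad (P b) \<bullet> P a) * inverse (grad (P b) \<bullet> P a)))"
proof -
  let ?W = "\<lambda>b. grad (P b)"
  have "partial i (\<lambda>b. partial j (logpair a) b) b =
     partial i (\<lambda>b. (D ?W b (axis j 1) \<bullet> P a) * inverse (?W b \<bullet> P a)) b"
    by (rule partial_cong[OF V_open assms(2)]) (rule partial_logpair[OF assms(1)])
  also have "\<dots> = (D (\<lambda>b. D ?W b (axis j 1)) b (axis i 1) \<bullet> P a) * inverse (?W b \<bullet> P a)
     + - ((D ?W b (axis j 1) \<bullet> P a) * (D ?W b (axis i 1) \<bullet> P a)
        * (inverse (?W b \<bullet> P a) * inverse (?W b \<bullet> P a)))"
    by (rule partial_eq[where f' = "\<lambda>w. (D (\<lambda>b. D ?W b (axis j 1)) b w \<bullet> P a) * inverse (?W b \<bullet> P a)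
     + - ((D ?W b (axis j 1) \<bullet> P a) * (D ?W b w \<bullet> P a)
        * (inverse (?W b \<bullet> P a) * inverse (?W b \<bullet> P a)))"])
      (use grad_P_pos[OF assms] Cinf_on_has_derivative[OF grad_P_Cinf assms(2)]
          Cinf_on_has_derivative[OF Cinf_on_D[OF grad_P_Cinf] assms(2)] in
        \<open>auto intro!: derivative_eq_intros simp: algebra_simps\<close>)
  finally show ?thesis .
qed

text \<open>
  The derivative of \<open>T\<close> in its second argument is a quotient of linear forms in the first argument whose
  numerator vanishes on the diagonal, so only the derivative of the numerator contributes.
\<close>

lemma metric_eq:
  assumes x: "x \<in> V"
  shows "metric \<phi> U \<xi> x $ i $ j
    = - (D grad (P x) (D P x (axis j 1)) \<bullet> D P x (axis i 1)) / (grad (P x) \<bullet> P x)"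
proof -
  let ?\<alpha> = "D grad (P x) (D P x (axis j 1))" and ?\<beta> = "grad (P x)"
  have pos: "?\<beta> \<bullet> P x > 0" by (rule grad_P_pos[OF x x])
  have zero: "?\<alpha> \<bullet> P x = 0" by (rule D_grad_inner_self[OF P_orthant[OF x]])
  have "metric \<phi> U \<xi> x $ i $ j = - partial i (\<lambda>a. partial j (\<lambda>b. L_div_coord \<phi> U \<xi> a b) x) x"
    by (simp add: metric_def)
  also have "partial i (\<lambda>a. partial j (\<lambda>b. L_div_coord \<phi> U \<xi> a b) x) x
      = partial i (\<lambda>a. (?\<alpha> \<bullet> P a) * inverse (?\<beta> \<bullet> P a)) x"
    by (rule partial_cong[OF V_open x]) (simp add: partial_L_div_coord partial_logpair x D_grad_P)
  also have "\<dots> = (?\<alpha> \<bullet> D P x (axis i 1)) / (?\<beta> \<bullet> P x)"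
    by (rule partial_eq[where f' = "\<lambda>w. (?\<alpha> \<bullet> D P x w) / (?\<beta> \<bullet> P x)"])
      (use pos zero P_has_derivative[OF x] in
        \<open>auto intro!: derivative_eq_intros simp: field_simps\<close>)
  finally show ?thesis by simp
qed

lemma metric_symmetric: "x \<in> V \<Longrightarrow> metric \<phi> U \<xi> x $ i $ j = metric \<phi> U \<xi> x $ j $ i"
  by (simp add: metric_eq D_grad_symmetric[OF P_orthant, of _ "D P x (axis i 1)"])

text \<open>
  The metric is the pull-back of minus the Hessian of \<open>\<Psi>\<close>, divided by the positive number \<open>\<Psi>\<close>, under the
  injective map \<open>D P x\<close>, and this Hessian is negative definite on tangent vectors.
\<close>

lemma metric_invertible:
  assumes x: "x \<in> V" shows "invertible (metric \<phi> U \<xi> x)"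
proof -
  let ?g = "metric \<phi> U \<xi> x"
  have "w = 0" if "?g *v w = 0" for w
  proof -
    define z where "z = D P x w"
    have lin: "linear (D grad (P x))"
      by (rule linear_frechet_derivative[OF Cinf_on_differentiable[OF grad_Cinf P_orthant[OF x]]])
    have z: "D grad (P x) z = (\<Sum>j\<in>UNIV. w $ j *\<^sub>R D grad (P x) (D P x (axis j 1)))"
      unfolding z_def D_P_expand[OF x, of w] linear_sum[OF lin] linear_cmul[OF lin] ..
    have "(?g *v w) $ i = - (D grad (P x) z \<bullet> D P x (axis i 1)) / (grad (P x) \<bullet> P x)" for i
      unfolding z matrix_vector_mult_def
      by (simp add: metric_eq[OF x] inner_sum_left sum_divide_distrib sum_negf mult.commute)
    then have "D grad (P x) z \<bullet> D P x (axis i 1) = 0" for i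
      using that grad_P_pos[OF x x] by simp
    then have "D grad (P x) z \<bullet> z = 0"
      by (rule orthogonal_tangentI[OF x]) (simp add: z_def coord_sum_D_P[OF x])
    then have "z = 0"
      using D_grad_neg_def[OF U_simplex[OF P_in_U[OF x]] coord_sum_D_P[OF x]] unfolding z_def by force
    then show ?thesis using D_P_inj[OF x] by (simp add: z_def)
  qed
  then show ?thesis
    unfolding invertible_left_inverse matrix_left_invertible_ker by blast
qed

text \<open>
  The curve is differentiable relative to \<open>{0..1}\<close> and \<open>\<xi>\<close> is defined on a subset of a hyperplane, so the
  chain rule is applied to a local smooth extension of \<open>\<xi>\<close> to an open set.
\<close>

lemma curve_in_chart:
  assumes \<gamma>: "twice_deriv_at \<gamma> \<gamma>1 \<gamma>2 t" and simplex: "\<gamma> ` {0..1} \<subseteq> open_simplex" and t: "\<gamma> t \<in> U"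
  obtains M c1 c2 where "open M" "t \<in> M" "\<And>s. s \<in> M \<Longrightarrow> s \<in> {0..1} \<Longrightarrow> \<gamma> s \<in> U"
    "twice_deriv_at (\<lambda>s. \<xi> (\<gamma> s)) c1 c2 t"
proof -
  obtain N \<Xi> where N: "open N" "\<gamma> t \<in> N" "Cinf_on N \<Xi>" "\<And>q. q \<in> N \<Longrightarrow> q \<in> open_simplex \<Longrightarrow> q \<in> U \<and> \<Xi> q = \<xi> q"
    by (rule \<xi>_extension[OF t]) (rule that)
  have "continuous (at t within {0..1}) \<gamma>"
    by (rule has_vector_derivative_continuous[OF twice_deriv_at_deriv[OF \<gamma>]])
  then obtain M where M: "open M" "t \<in> M" "\<And>s. s \<in> M \<Longrightarrow> s \<in> {0..1} \<Longrightarrow> \<gamma> s \<in> N"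
    using N(1,2) unfolding continuous_within_topological by meson
  have in_U: "\<gamma> s \<in> U \<and> \<Xi> (\<gamma> s) = \<xi> (\<gamma> s)" if "s \<in> M" "s \<in> {0..1}" for s
    by (rule N(4)[OF M(3)[OF that]]) (use simplex that(2) in blast)
  have "twice_deriv_at (\<lambda>s. \<xi> (\<gamma> s)) (\<lambda>s. D \<Xi> (\<gamma> s) (\<gamma>1 s))
    ((\<Sum>i\<in>Basis. \<Sum>j\<in>Basis. (\<gamma>1 t \<bullet> i) *\<^sub>R (\<gamma>1 t \<bullet> j) *\<^sub>R D (\<lambda>x. D \<Xi> x j) (\<gamma> t) i)
      + (\<Sum>i\<in>Basis. (\<gamma>2 \<bullet> i) *\<^sub>R D \<Xi> (\<gamma> t) i)) t"
    by (rule twice_deriv_at_cong[OF twice_deriv_at_compose[OF N(3) \<gamma> N(2)] M(1,2)]) (simp add: in_U)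
  with M(1,2) in_U show thesis by (intro that) auto
qed

lemma geodesic_eq_lowered:
  assumes c: "twice_deriv_at c c1 c2 t" and x: "c t \<in> V"
    and geo: "geodesic_eq_at (\<lambda>x. raise_last (metric \<phi> U \<xi> x) (\<Gamma> x)) c t"
  shows "(\<Sum>k\<in>UNIV. c2 $ k * metric \<phi> U \<xi> (c t) $ k $ m)
    + (\<Sum>i\<in>UNIV. \<Sum>j\<in>UNIV. \<Gamma> (c t) i j m * c1 t $ i * c1 t $ j) = 0"
  using geo twice_deriv_at_vector_derivative(2,3)[OF c]
  by (intro lower_raised_index metric_invertible x) (simp add: geodesic_eq_at_def Let_def)

text \<open>
  With the last index lowered, the geodesic equation is the chain rule formula for the second derivative
  of the functions \<open>Q\<close>, the coordinate expressions of \<open>q \<mapsto> \<partial>T(q | p)\<close>, along the curve. Hence that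
  derivative vanishes. The quotient rule turns this into orthogonality relations for
  \<open>z = \<gamma>'' - a \<gamma>'\<close>, and definiteness of the Hessian forces \<open>z = 0\<close>.
\<close>

lemma primal_geodesic_acceleration:
  assumes \<gamma>: "twice_deriv_at \<gamma> \<gamma>1 \<gamma>2 t" and simplex: "\<gamma> ` {0..1} \<subseteq> open_simplex" and t: "\<gamma> t \<in> U"
    and tangent: "coord_sum (\<gamma>1 t) = 0" "coord_sum \<gamma>2 = 0"
    and geo: "geodesic_eq_at (\<lambda>x. raise_last (metric \<phi> U \<xi> x) (Gamma_primal \<phi> U \<xi> x)) (\<lambda>s. \<xi> (\<gamma> s)) t"
  shows "\<gamma>2 = (2 * (grad (\<gamma> t) \<bullet> \<gamma>1 t) / (grad (\<gamma> t) \<bullet> \<gamma> t)) *\<^sub>R \<gamma>1 t"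
proof -
  obtain M c1 c2 where M: "open M" "t \<in> M" "\<And>s. s \<in> M \<Longrightarrow> s \<in> {0..1} \<Longrightarrow> \<gamma> s \<in> U"
    and c: "twice_deriv_at (\<lambda>s. \<xi> (\<gamma> s)) c1 c2 t"
    by (rule curve_in_chart[OF \<gamma> simplex t]) (rule that)
  define p x where "p = \<gamma> t" and "x = \<xi> p"
  have x: "x \<in> V" "P x = p" using t by (simp_all add: x_def p_def \<xi>_in_V P_\<xi>)
  define B where "B = grad p \<bullet> p"
  have B: "B > 0" using grad_P_pos[OF x(1) x(1)] by (simp add: B_def x(2))
  define z where "z = \<gamma>2 - (2 * (grad p \<bullet> \<gamma>1 t) / B) *\<^sub>R \<gamma>1 t"
  have "D grad p (D P x (axis m 1)) \<bullet> z = 0" for m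
  proof -
    define \<alpha> where "\<alpha> = D grad p (D P x (axis m 1))"
    define Q where "Q = (\<lambda>a. (\<alpha> \<bullet> P a) * inverse (grad p \<bullet> P a))"
    have pos: "grad p \<bullet> P a > 0" if "a \<in> V" for a
      using grad_P_pos[OF that x(1)] by (simp add: x(2))
    have Q: "Cinf_on V Q" unfolding Q_def
      by (intro Cinf_on_mult Cinf_on_inverse Cinf_on_inner Cinf_on_const V_open P_Cinf pos)
    have Q_eq: "partial m (L_div_coord \<phi> U \<xi> a) x = Q a" if "a \<in> V" for a
      by (simp add: partial_L_div_coord partial_logpair that x D_grad_P Q_def \<alpha>_def)
    have g: "metric \<phi> U \<xi> x $ i $ m = - partial i Q x" for i
      using partial_cong[OF V_open x(1) Q_eq] by (simp add: metric_def)
    have "partial j (\<lambda>a'. partial m (L_div_coord \<phi> U \<xi> a') x) a = partial j Q a" if "a \<in> V" for a j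
      by (rule partial_cong[OF V_open that Q_eq])
    then have \<Gamma>: "Gamma_primal \<phi> U \<xi> x i j m = - partial i (\<lambda>a. partial j Q a) x" for i j
      unfolding Gamma_primal_def by (intro arg_cong[of _ _ uminus] partial_cong[OF V_open x(1)])
    have "(\<Sum>k\<in>UNIV. c2 $ k * - partial k Q x)
        + (\<Sum>i\<in>UNIV. \<Sum>j\<in>UNIV. - partial i (\<lambda>a. partial j Q a) x * c1 t $ i * c1 t $ j) = 0"
      using geodesic_eq_lowered[OF c _ geo, of m] x(1) by (simp only: g \<Gamma> flip: p_def x_def)
    then have "(\<Sum>i\<in>UNIV. \<Sum>j\<in>UNIV. c1 t $ i * c1 t $ j * partial i (\<lambda>a. partial j Q a) x)
        + (\<Sum>k\<in>UNIV. c2 $ k * partial k Q x) = 0"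
      by (simp add: sum_negf mult_ac)
    then have "\<exists>f1. twice_deriv_at (\<lambda>s. Q (\<xi> (\<gamma> s))) f1 0 t"
      using twice_deriv_at_compose_partial[OF Q c] x(1) by (simp flip: p_def x_def)
    then obtain f1 where "twice_deriv_at (\<lambda>s. Q (\<xi> (\<gamma> s))) f1 0 t" ..
    then have zero: "twice_deriv_at (\<lambda>s. (\<alpha> \<bullet> \<gamma> s) / (grad p \<bullet> \<gamma> s)) f1 0 t"
      by (rule twice_deriv_at_cong[OF _ M(1,2)]) (simp add: Q_def P_\<xi> M(3) divide_inverse)
    \<comment> \<open>The two terms of the second derivative that contain the undifferentiated numerator vanish at \<open>t\<close>.\<close>
    have "twice_deriv_at (\<lambda>s. (\<alpha> \<bullet> \<gamma> s) / (grad p \<bullet> \<gamma> s))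
      (\<lambda>s. ((\<alpha> \<bullet> \<gamma>1 s) * (grad p \<bullet> \<gamma> s) - (\<alpha> \<bullet> \<gamma> s) * (grad p \<bullet> \<gamma>1 s)) / ((grad p \<bullet> \<gamma> s) * (grad p \<bullet> \<gamma> s)))
      ((\<alpha> \<bullet> \<gamma>2) / (grad p \<bullet> \<gamma> t) - 2 * (\<alpha> \<bullet> \<gamma>1 t) * (grad p \<bullet> \<gamma>1 t) / (grad p \<bullet> \<gamma> t)^2
        - (\<alpha> \<bullet> \<gamma> t) * (grad p \<bullet> \<gamma>2) / (grad p \<bullet> \<gamma> t)^2
        + 2 * (\<alpha> \<bullet> \<gamma> t) * (grad p \<bullet> \<gamma>1 t)^2 / (grad p \<bullet> \<gamma> t)^3) t"
    proof (rule twice_deriv_at_divide)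
      show "grad p \<bullet> \<gamma> s \<noteq> 0" if "s \<in> {0..1}" for s
      proof -
        have "\<gamma> s \<in> open_simplex" using simplex that by blast
        then have "grad p \<bullet> \<gamma> s > 0" unfolding p_def by (rule grad_inner_pos[OF U_simplex[OF t]])
        then show ?thesis by simp
      qed
    qed (rule twice_deriv_at_linear[OF bounded_linear_inner_right \<gamma>])+
    from twice_deriv_at_unique(2)[OF this zero]
    have "(\<alpha> \<bullet> \<gamma>2) / B - 2 * (\<alpha> \<bullet> \<gamma>1 t) * (grad p \<bullet> \<gamma>1 t) / B^2 = 0"
      using D_grad_inner_self[OF P_orthant[OF x(1)]] by (simp add: \<alpha>_def B_def x(2) flip: p_def)
    moreover have "(\<alpha> \<bullet> \<gamma>2) / B - 2 * (\<alpha> \<bullet> \<gamma>1 t) * (grad p \<bullet> \<gamma>1 t) / B^2 = (\<alpha> \<bullet> z) / B"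
      using B unfolding z_def inner_diff_right inner_scaleR_right
      by (simp add: diff_divide_distrib power2_eq_square mult_ac)
    ultimately show ?thesis
      using B unfolding \<alpha>_def by simp
  qed
  then have "D grad p z \<bullet> D P x (axis m 1) = 0" for m
    using D_grad_symmetric[OF P_orthant[OF x(1)], of z "D P x (axis m 1)"] by (simp only: x(2))
  moreover have z: "coord_sum z = 0"
    using tangent by (simp add: z_def coord_sum_simps)
  ultimately have "D grad p z \<bullet> z = 0"
    by (rule orthogonal_tangentI[OF x(1)])
  then have "z = 0"
    using D_grad_neg_def[OF U_simplex[OF t] z] unfolding p_def by fastforce
  then show ?thesis by (simp add: z_def B_def p_def)
qed

text \<open>
  The dual Christoffel symbols differentiate in the first argument of \<open>T\<close> last. Accordingly, \<open>E a\<close> is the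
  second time derivative of \<open>T(a | \<gamma>)\<close> at \<open>t\<close>, and the geodesic equation states that the first derivative of \<open>E\<close> vanishes at the coordinates \<open>x\<close> of \<open>\<gamma> t\<close>. Computing \<open>E\<close>
  directly from \<open>ln (w \<bullet> q)\<close> makes this condition explicit.
\<close>

lemma dual_geodesic_acceleration:
  assumes \<gamma>: "twice_deriv_at \<gamma> \<gamma>1 \<gamma>2 t" and simplex: "\<gamma> ` {0..1} \<subseteq> open_simplex" and t: "\<gamma> t \<in> U"
    and w: "twice_deriv_at (\<lambda>s. grad (\<gamma> s)) w1 w2 t"
    and geo: "geodesic_eq_at (\<lambda>x. raise_last (metric \<phi> U \<xi> x) (Gamma_dual \<phi> U \<xi> x)) (\<lambda>s. \<xi> (\<gamma> s)) t"
  shows "\<exists>b. w2 = (2 * (w1 t \<bullet> \<gamma> t) / (grad (\<gamma> t) \<bullet> \<gamma> t)) *\<^sub>R w1 t + b *\<^sub>R grad (\<gamma> t)"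
proof -
  obtain M c1 c2 where M: "open M" "t \<in> M" "\<And>s. s \<in> M \<Longrightarrow> s \<in> {0..1} \<Longrightarrow> \<gamma> s \<in> U"
    and c: "twice_deriv_at (\<lambda>s. \<xi> (\<gamma> s)) c1 c2 t"
    by (rule curve_in_chart[OF \<gamma> simplex t]) (rule that)
  define p x where "p = \<gamma> t" and "x = \<xi> p"
  have x: "x \<in> V" "P x = p" using t by (simp_all add: x_def p_def \<xi>_in_V P_\<xi>)
  define y where "y = grad p"
  define B where "B = y \<bullet> p"
  have B: "B > 0" using grad_P_pos[OF x(1) x(1)] by (simp add: B_def y_def x(2))
  have pos: "y \<bullet> P a > 0" if "a \<in> V" for a
    using grad_P_pos[OF that x(1)] by (simp add: x(2) y_def)
  define A1 where "A1 = (\<lambda>i a. partial i (logpair a) x)"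
  define A2 where "A2 = (\<lambda>i j a. partial i (\<lambda>b. partial j (logpair a) b) x)"
  have A1: "Cinf_on V (A1 i)" for i
  proof (rule Cinf_on_cong)
    show "Cinf_on V (\<lambda>a. (D (\<lambda>b. grad (P b)) x (axis i 1) \<bullet> P a) * inverse (y \<bullet> P a))"
      by (intro Cinf_on_mult Cinf_on_inverse Cinf_on_inner Cinf_on_const V_open P_Cinf pos)
  qed (simp add: A1_def partial_logpair x y_def)
  have A2: "Cinf_on V (A2 i j)" for i j
  proof (rule Cinf_on_cong)
    show "Cinf_on V (\<lambda>a. (D (\<lambda>b. D (\<lambda>b. grad (P b)) b (axis j 1)) x (axis i 1) \<bullet> P a) * inverse (y \<bullet> P a)
       + - 1 * ((D (\<lambda>b. grad (P b)) x (axis j 1) \<bullet> P a) * (D (\<lambda>b. grad (P b)) x (axis i 1) \<bullet> P a)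
          * (inverse (y \<bullet> P a) * inverse (y \<bullet> P a))))"
      by (intro Cinf_on_add Cinf_on_mult Cinf_on_inverse Cinf_on_inner Cinf_on_const V_open P_Cinf pos)
  qed (simp add: A2_def partial_partial_logpair x y_def)
  define E where "E = (\<lambda>a. (\<Sum>i\<in>UNIV. \<Sum>j\<in>UNIV. c1 t $ i * c1 t $ j * A2 i j a) + (\<Sum>i\<in>UNIV. c2 $ i * A1 i a))"
  have E_eq: "E a = (w2 \<bullet> P a) / (y \<bullet> P a) - ((w1 t \<bullet> P a) / (y \<bullet> P a))^2" if a: "a \<in> V" for a
  proof -
    have "\<exists>f1. twice_deriv_at (\<lambda>s. logpair a (\<xi> (\<gamma> s))) f1 (E a) t"
      using twice_deriv_at_compose_partial[OF logpair_Cinf[OF a] c] x(1)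
      unfolding E_def A1_def A2_def x_def p_def by simp
    then obtain f1 where "twice_deriv_at (\<lambda>s. logpair a (\<xi> (\<gamma> s))) f1 (E a) t" ..
    then have "twice_deriv_at (\<lambda>s. ln (grad (\<gamma> s) \<bullet> P a)) f1 (E a) t"
      by (rule twice_deriv_at_cong[OF _ M(1,2)]) (simp add: logpair_def P_\<xi> M(3))
    moreover have "twice_deriv_at (\<lambda>s. ln (grad (\<gamma> s) \<bullet> P a)) (\<lambda>s. (w1 s \<bullet> P a) / (grad (\<gamma> s) \<bullet> P a))
      ((w2 \<bullet> P a) / (grad (\<gamma> t) \<bullet> P a) - ((w1 t \<bullet> P a) / (grad (\<gamma> t) \<bullet> P a))^2) t"
    proof (rule twice_deriv_at_ln)
      show "grad (\<gamma> s) \<bullet> P a > 0" if "s \<in> {0..1}" for s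
        using that simplex a by (intro grad_inner_pos U_simplex[OF P_in_U]) auto
    qed (rule twice_deriv_at_linear[OF bounded_linear_inner_left w])
    ultimately show ?thesis
      unfolding y_def p_def by (rule twice_deriv_at_unique(2))
  qed
  have first_order: "(w2 \<bullet> v) / B - (w2 \<bullet> p) * (y \<bullet> v) / B^2
      - 2 * ((w1 t \<bullet> p) / B) * ((w1 t \<bullet> v) / B - (w1 t \<bullet> p) * (y \<bullet> v) / B^2) = 0"
    if v: "v = D P x (axis m 1)" for v m
  proof -
    have "partial m (\<lambda>a. (w2 \<bullet> P a) / (y \<bullet> P a) - ((w1 t \<bullet> P a) / (y \<bullet> P a))^2) x
      = (w2 \<bullet> v) / B - (w2 \<bullet> p) * (y \<bullet> v) / B^2
      - 2 * ((w1 t \<bullet> p) / B) * ((w1 t \<bullet> v) / B - (w1 t \<bullet> p) * (y \<bullet> v) / B^2)"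
      unfolding v
      by (rule partial_eq[where f' = "\<lambda>h. (w2 \<bullet> D P x h) / B - (w2 \<bullet> p) * (y \<bullet> D P x h) / B^2
        - 2 * ((w1 t \<bullet> p) / B) * ((w1 t \<bullet> D P x h) / B - (w1 t \<bullet> p) * (y \<bullet> D P x h) / B^2)"])
        (use B P_has_derivative[OF x(1)] in
          \<open>auto intro!: derivative_eq_intros simp: x(2) field_simps power2_eq_square simp flip: B_def\<close>)
    also have "partial m (\<lambda>a. (w2 \<bullet> P a) / (y \<bullet> P a) - ((w1 t \<bullet> P a) / (y \<bullet> P a))^2) x = partial m E x"
      by (rule partial_cong[OF V_open x(1)]) (simp add: E_eq)
    also have "partial m E x = (\<Sum>i\<in>UNIV. \<Sum>j\<in>UNIV. c1 t $ i * c1 t $ j * partial m (A2 i j) x)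
        + (\<Sum>i\<in>UNIV. c2 $ i * partial m (A1 i) x)"
      unfolding E_def partial_Cinf[OF A1 x(1)] partial_Cinf[OF A2 x(1)]
      by (rule partial_eq) (intro has_derivative_add has_derivative_sum has_derivative_mult_right
          Cinf_on_has_derivative[OF A1 x(1)] Cinf_on_has_derivative[OF A2 x(1)])
    also have "\<dots> = 0"
    proof -
      have g: "metric \<phi> U \<xi> x $ i $ m = - partial m (A1 i) x" for i
      proof -
        have "partial m (\<lambda>a. partial i (L_div_coord \<phi> U \<xi> a) x) x = partial m (A1 i) x"
          by (rule partial_cong[OF V_open x(1)]) (simp add: A1_def partial_L_div_coord x(1))
        then have "metric \<phi> U \<xi> x $ m $ i = - partial m (A1 i) x" by (simp add: metric_def)
        then show ?thesis using metric_symmetric[OF x(1)] by simp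
      qed
      have \<Gamma>: "Gamma_dual \<phi> U \<xi> x i j m = - partial m (A2 i j) x" for i j
      proof -
        have "partial i (\<lambda>b. partial j (L_div_coord \<phi> U \<xi> a) b) x = A2 i j a" if "a \<in> V" for a
          unfolding A2_def by (rule partial_cong[OF V_open x(1) partial_L_div_coord[OF that]])
        then show ?thesis
          unfolding Gamma_dual_def by (intro arg_cong[of _ _ uminus] partial_cong[OF V_open x(1)])
      qed
      have "(\<Sum>k\<in>UNIV. c2 $ k * - partial m (A1 k) x)
          + (\<Sum>i\<in>UNIV. \<Sum>j\<in>UNIV. - partial m (A2 i j) x * c1 t $ i * c1 t $ j) = 0"
        using geodesic_eq_lowered[OF c _ geo, of m] x(1) by (simp only: g \<Gamma> flip: p_def x_def)
      then show ?thesis by (simp add: sum_negf mult_ac)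
    qed
    finally show ?thesis by simp
  qed
  \<comment> \<open>The coefficients are chosen such that \<open>z\<close> below is orthogonal to the tangent vectors and to \<open>p\<close>, which together span the whole space.\<close>
  define a where "a = 2 * (w1 t \<bullet> p) / B"
  define b where "b = (w2 \<bullet> p) / B - 2 * (w1 t \<bullet> p)^2 / B^2"
  define z where "z = w2 - a *\<^sub>R w1 t - b *\<^sub>R y"
  have "z \<bullet> D P x (axis m 1) = 0" for m
  proof -
    let ?v = "D P x (axis m 1)"
    have "z \<bullet> ?v = w2 \<bullet> ?v - a * (w1 t \<bullet> ?v) - b * (y \<bullet> ?v)"
      by (simp add: z_def inner_diff_left)
    also have "\<dots> = B * ((w2 \<bullet> ?v) / B - (w2 \<bullet> p) * (y \<bullet> ?v) / B^2
      - 2 * ((w1 t \<bullet> p) / B) * ((w1 t \<bullet> ?v) / B - (w1 t \<bullet> p) * (y \<bullet> ?v) / B^2))"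
      using B by (simp add: a_def b_def field_simps power2_eq_square)
    finally have "z \<bullet> ?v = \<dots>" .
    then show ?thesis using first_order[OF refl, of m] by simp
  qed
  note tangent = orthogonal_tangentI[OF x(1) this]
  have radial: "z \<bullet> p = 0"
  proof -
    have "z \<bullet> p = w2 \<bullet> p - a * (w1 t \<bullet> p) - b * B"
      by (simp add: z_def inner_diff_left B_def)
    then show ?thesis using B by (simp add: a_def b_def field_simps power2_eq_square)
  qed
  have "z \<bullet> z = 0"
  proof -
    have "coord_sum (z - coord_sum z *\<^sub>R p) = 0"
      using U_simplex[OF t] by (simp add: coord_sum_simps open_simplex_iff p_def)
    then have "z \<bullet> (z - coord_sum z *\<^sub>R p) = 0" by (rule tangent)
    then show ?thesis by (simp add: inner_diff_right radial)
  qed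
  then have "z = 0" by (simp only: inner_eq_zero_iff)
  then have "w2 = a *\<^sub>R w1 t + b *\<^sub>R y" by (simp add: z_def algebra_simps)
  then show ?thesis by (auto simp: a_def B_def y_def p_def)
qed

end

section \<open>Traces of geodesics\<close>

context strictly_exp_concave
begin

lemma primal_geodesic_image:
  assumes "primal_geodesic \<phi> \<gamma>"
  shows "\<gamma> ` {0..1} = closed_segment (\<gamma> 0) (\<gamma> 1)"
proof -
  define \<gamma>1 where "\<gamma>1 = (\<lambda>s. vector_derivative \<gamma> (at s within {0..1}))"
  define \<gamma>2 where "\<gamma>2 = (\<lambda>s. vector_derivative \<gamma>1 (at s within {0..1}))"
  have simplex: "\<gamma> ` {0..1} \<subseteq> open_simplex" and sm: "smooth_on {0..1} \<gamma>"
    using assms by (simp_all add: primal_geodesic_def)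
  have \<gamma>: "twice_deriv_at \<gamma> \<gamma>1 (\<gamma>2 t) t" if "t \<in> {0..1}" for t
    using smooth_on_imp_twice_deriv_at[OF sm that] by (simp add: \<gamma>1_def \<gamma>2_def)
  have in_simplex: "\<gamma> t \<in> open_simplex" if "t \<in> {0..1}" for t
    using simplex that by auto
  then have orth: "\<gamma> t \<in> orthant" if "t \<in> {0..1}" for t
    using that by (simp add: open_simplex_iff)
  have tangent: "coord_sum (\<gamma>1 t) = 0 \<and> coord_sum (\<gamma>2 t) = 0" if "t \<in> {0..1}" for t
  proof -
    have 1: "twice_deriv_at (\<lambda>s. coord_sum (\<gamma> s)) (\<lambda>s. coord_sum (\<gamma>1 s)) (coord_sum (\<gamma>2 t)) t"
      by (rule twice_deriv_at_linear[OF bounded_linear_coord_sum \<gamma>[OF that]])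
    have 2: "twice_deriv_at (\<lambda>s. coord_sum (\<gamma> s)) (\<lambda>s. 0) 0 t"
      by (rule twice_deriv_at_cong[OF twice_deriv_at_const[OF that, of 1] open_UNIV])
        (use in_simplex in \<open>auto simp only: open_simplex_iff\<close>)
    show ?thesis using twice_deriv_at_unique[OF 1 2] by simp
  qed
  define a where "a = (\<lambda>t. 2 * (grad (\<gamma> t) \<bullet> \<gamma>1 t) / (grad (\<gamma> t) \<bullet> \<gamma> t))"
  have acc: "\<gamma>2 t = a t *\<^sub>R \<gamma>1 t" if t: "t \<in> {0..1}" for t
  proof -
    obtain U \<xi> where "coord_system U \<xi>" "\<gamma> t \<in> U"
      and geo: "geodesic_eq_at (\<lambda>x. raise_last (metric \<phi> U \<xi> x) (Gamma_primal \<phi> U \<xi> x)) (\<lambda>s. \<xi> (\<gamma> s)) t"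
      using assms t unfolding primal_geodesic_def by blast
    then interpret chart \<phi> U \<xi> by unfold_locales
    show ?thesis unfolding a_def
      by (rule primal_geodesic_acceleration[OF \<gamma>[OF t] simplex \<open>\<gamma> t \<in> U\<close> _ _ geo]) (use tangent[OF t] in auto)
  qed
  have cont: "continuous_on {0..1} \<gamma>" "continuous_on {0..1} \<gamma>1"
    unfolding continuous_on_eq_continuous_within
    by (intro ballI has_vector_derivative_continuous[OF twice_deriv_at_deriv[OF \<gamma>]]
        has_vector_derivative_continuous[OF twice_deriv_at_deriv2[OF \<gamma>]]; assumption)+
  have denominator: "grad (\<gamma> t) \<bullet> \<gamma> t \<noteq> 0" if "t \<in> {0..1}" for t
    using grad_inner_pos[OF in_simplex in_simplex, OF that that] by simp
  have "continuous_on {0..1} (\<lambda>t. grad (\<gamma> t))"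
    by (rule continuous_on_compose2[OF Cinf_on_continuous[OF grad_Cinf] cont(1)]) (use orth in auto)
  then have "continuous_on {0..1} a" unfolding a_def
    by (intro continuous_intros cont ballI denominator)
  then show ?thesis
    using \<gamma>[THEN twice_deriv_at_deriv] \<gamma>[THEN twice_deriv_at_deriv2] acc
    by (intro image_eq_closed_segment_of_collinear_acceleration[of \<gamma> \<gamma>1 a]) auto
qed

text \<open>
  The curve \<open>w = grad \<circ> \<gamma>\<close> satisfies \<open>w'' = a w' + b w\<close>. Its rescaling \<open>u = w / \<sigma>\<close>, where \<open>\<sigma>\<close> is the
  coordinate sum of \<open>w\<close>, satisfies \<open>u'' = (a - 2 \<sigma>' / \<sigma>) u'\<close>: because \<open>\<sigma>\<close> solves the same equation as
  \<open>w\<close>, the terms with \<open>b\<close> cancel.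
\<close>

lemma dual_geodesic_image:
  assumes "dual_geodesic \<phi> \<gamma>"
  shows "(\<lambda>t. dual_euclid \<phi> (\<gamma> t)) ` {0..1}
    = closed_segment (dual_euclid \<phi> (\<gamma> 0)) (dual_euclid \<phi> (\<gamma> 1))"
proof -
  define \<gamma>1 where "\<gamma>1 = (\<lambda>s. vector_derivative \<gamma> (at s within {0..1}))"
  define \<gamma>2 where "\<gamma>2 = (\<lambda>s. vector_derivative \<gamma>1 (at s within {0..1}))"
  have simplex: "\<gamma> ` {0..1} \<subseteq> open_simplex" and sm: "smooth_on {0..1} \<gamma>"
    using assms by (simp_all add: dual_geodesic_def)
  have in_simplex: "\<gamma> t \<in> open_simplex" if "t \<in> {0..1}" for t
    using simplex that by auto
  then have orth: "\<gamma> t \<in> orthant" if "t \<in> {0..1}" for t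
    using that by (simp add: open_simplex_iff)
  have \<gamma>: "twice_deriv_at \<gamma> \<gamma>1 (\<gamma>2 t) t" if "t \<in> {0..1}" for t
    using smooth_on_imp_twice_deriv_at[OF sm that] by (simp add: \<gamma>1_def \<gamma>2_def)
  define w where "w = (\<lambda>s. grad (\<gamma> s))"
  define w1 where "w1 = (\<lambda>s. vector_derivative w (at s within {0..1}))"
  define w2 where "w2 = (\<lambda>s. vector_derivative w1 (at s within {0..1}))"
  have w: "twice_deriv_at w w1 (w2 t) t" if "t \<in> {0..1}" for t
  proof -
    from twice_deriv_at_compose[OF grad_Cinf \<gamma>[OF that] orth[OF that], folded w_def]
    obtain f1 f2 where f: "twice_deriv_at w f1 f2 t" by (rule that)
    show ?thesis
      using twice_deriv_at_vector_derivative(1)[OF f] twice_deriv_at_vector_derivative(3)[OF f]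
      by (simp add: w1_def w2_def)
  qed
  define a where "a = (\<lambda>t. 2 * (w1 t \<bullet> \<gamma> t) / (w t \<bullet> \<gamma> t))"
  have "\<exists>b. w2 t = a t *\<^sub>R w1 t + b *\<^sub>R w t" if t: "t \<in> {0..1}" for t
  proof -
    obtain U \<xi> where "coord_system U \<xi>" "\<gamma> t \<in> U"
      and geo: "geodesic_eq_at (\<lambda>x. raise_last (metric \<phi> U \<xi> x) (Gamma_dual \<phi> U \<xi> x)) (\<lambda>s. \<xi> (\<gamma> s)) t"
      using assms t unfolding dual_geodesic_def by blast
    then interpret chart \<phi> U \<xi> by unfold_locales
    show ?thesis
      using dual_geodesic_acceleration[OF \<gamma>[OF t] simplex \<open>\<gamma> t \<in> U\<close> w[OF t, unfolded w_def] geo]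
      by (simp add: a_def w_def)
  qed
  then obtain b where acc: "\<And>t. t \<in> {0..1} \<Longrightarrow> w2 t = a t *\<^sub>R w1 t + b t *\<^sub>R w t"
    by metis
  define \<sigma> \<sigma>1 where "\<sigma> = (\<lambda>t. coord_sum (w t))" and "\<sigma>1 = (\<lambda>t. coord_sum (w1 t))"
  have \<sigma>_pos: "\<sigma> t > 0" if "t \<in> {0..1}" for t
    using grad_nth_pos[OF in_simplex[OF that]] by (auto simp: \<sigma>_def w_def coord_sum_def intro!: sum_pos)
  have w_d: "(w has_vector_derivative w1 t) (at t within {0..1})"
    "(w1 has_vector_derivative w2 t) (at t within {0..1})" if "t \<in> {0..1}" for t
    using twice_deriv_at_deriv[OF w[OF that]] twice_deriv_at_deriv2[OF w[OF that]] by simp_all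
  have \<sigma>_d: "(\<sigma> has_real_derivative \<sigma>1 t) (at t within {0..1})"
    "(\<sigma>1 has_real_derivative a t * \<sigma>1 t + b t * \<sigma> t) (at t within {0..1})" if "t \<in> {0..1}" for t
    using bounded_linear.has_vector_derivative[OF bounded_linear_coord_sum w_d(1)[OF that]]
      bounded_linear.has_vector_derivative[OF bounded_linear_coord_sum w_d(2)[OF that]]
    by (simp_all add: \<sigma>_def \<sigma>1_def acc[OF that] coord_sum_simps has_real_derivative_iff_has_vector_derivative)
  define u u1 where "u = (\<lambda>t. inverse (\<sigma> t) *\<^sub>R w t)"
    and "u1 = (\<lambda>t. inverse (\<sigma> t) *\<^sub>R w1 t + (- (inverse (\<sigma> t) * \<sigma>1 t * inverse (\<sigma> t))) *\<^sub>R w t)"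
  have inv: "((\<lambda>t. inverse (\<sigma> t)) has_real_derivative - (inverse (\<sigma> t) * \<sigma>1 t * inverse (\<sigma> t))) (at t within {0..1})"
    if "t \<in> {0..1}" for t
    using \<sigma>_pos[OF that] by (intro DERIV_inverse' \<sigma>_d that) simp
  have u: "(u has_vector_derivative u1 t) (at t within {0..1})" if "t \<in> {0..1}" for t
    unfolding u_def u1_def by (intro has_vector_derivative_scaleR inv w_d that)
  have u1: "(u1 has_vector_derivative (a t - 2 * \<sigma>1 t / \<sigma> t) *\<^sub>R u1 t) (at t within {0..1})" if "t \<in> {0..1}" for t
  proof -
    define i where "i = inverse (\<sigma> t)"
    have i: "i * \<sigma> t = 1" using \<sigma>_pos[OF that] by (simp add: i_def)
    have "((\<lambda>t. - (inverse (\<sigma> t) * \<sigma>1 t * inverse (\<sigma> t))) has_real_derivative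
        - (a t * \<sigma>1 t * i^2 + b t * i) + 2 * \<sigma>1 t^2 * i^3) (at t within {0..1})"
    proof (rule DERIV_cong)
      show "((\<lambda>t. - (inverse (\<sigma> t) * \<sigma>1 t * inverse (\<sigma> t))) has_real_derivative
        - ((- (i * \<sigma>1 t * i) * \<sigma>1 t + (a t * \<sigma>1 t + b t * \<sigma> t) * i) * i + - (i * \<sigma>1 t * i) * (i * \<sigma>1 t)))
        (at t within {0..1})"
        unfolding i_def by (intro DERIV_minus DERIV_mult inv \<sigma>_d that)
      have "b t * \<sigma> t * i * i = b t * i * (i * \<sigma> t)" by (simp add: mult_ac)
      then show "- ((- (i * \<sigma>1 t * i) * \<sigma>1 t + (a t * \<sigma>1 t + b t * \<sigma> t) * i) * i + - (i * \<sigma>1 t * i) * (i * \<sigma>1 t))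
        = - (a t * \<sigma>1 t * i^2 + b t * i) + 2 * \<sigma>1 t^2 * i^3"
        by (simp add: i algebra_simps power2_eq_square power3_eq_cube)
    qed
    then have "(u1 has_vector_derivative
       (i *\<^sub>R w2 t + (- (i * \<sigma>1 t * i)) *\<^sub>R w1 t) +
       ((- (i * \<sigma>1 t * i)) *\<^sub>R w1 t + (- (a t * \<sigma>1 t * i^2 + b t * i) + 2 * \<sigma>1 t^2 * i^3) *\<^sub>R w t)) (at t within {0..1})"
      unfolding u1_def i_def
      by (intro has_vector_derivative_add has_vector_derivative_scaleR inv w_d that)
    moreover have "(i *\<^sub>R w2 t + (- (i * \<sigma>1 t * i)) *\<^sub>R w1 t) +
       ((- (i * \<sigma>1 t * i)) *\<^sub>R w1 t + (- (a t * \<sigma>1 t * i^2 + b t * i) + 2 * \<sigma>1 t^2 * i^3) *\<^sub>R w t)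
       = (a t - 2 * \<sigma>1 t * i) *\<^sub>R (i *\<^sub>R w1 t + (- (i * \<sigma>1 t * i)) *\<^sub>R w t)"
      by (simp add: acc[OF that] vec_eq_iff algebra_simps power2_eq_square power3_eq_cube)
    ultimately show ?thesis by (simp add: u1_def i_def divide_inverse)
  qed
  have denominators: "w t \<bullet> \<gamma> t \<noteq> 0" "\<sigma> t \<noteq> 0" if "t \<in> {0..1}" for t
    using grad_inner_pos[OF in_simplex in_simplex, OF that that] \<sigma>_pos[OF that] by (simp_all add: w_def)
  have cont: "continuous_on {0..1} \<gamma>" "continuous_on {0..1} w" "continuous_on {0..1} w1"
    unfolding continuous_on_eq_continuous_within
    by (intro ballI has_vector_derivative_continuous[OF twice_deriv_at_deriv[OF \<gamma>]]
        has_vector_derivative_continuous[OF w_d(1)] has_vector_derivative_continuous[OF w_d(2)]; assumption)+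
  then have "continuous_on {0..1} \<sigma>" "continuous_on {0..1} \<sigma>1"
    unfolding \<sigma>_def \<sigma>1_def by (simp_all add: bounded_linear.continuous_on[OF bounded_linear_coord_sum])
  then have "continuous_on {0..1} (\<lambda>t. a t - 2 * \<sigma>1 t / \<sigma> t)" unfolding a_def
    by (intro continuous_intros cont ballI denominators)
  from image_eq_closed_segment_of_collinear_acceleration[OF u u1 this]
  have "u ` {0..1} = closed_segment (u 0) (u 1)" .
  moreover have dual: "dual_euclid \<phi> (\<gamma> t) = u t" if "t \<in> {0..1}" for t
    using dual_euclid_eq[OF in_simplex[OF that]] by (simp add: u_def w_def \<sigma>_def)
  moreover have "(\<lambda>t. dual_euclid \<phi> (\<gamma> t)) ` {0..1} = u ` {0..1}"
    by (rule image_cong[OF refl dual])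
  ultimately show ?thesis by simp
qed

end

theorem theorem5p1:
  fixes \<phi> :: "real ^ (('m::finite) option) \<Rightarrow> real"
  assumes "smooth_on open_simplex \<phi>"
    and "exp_concave \<phi>"
    and "\<And>p. p \<in> open_simplex \<Longrightarrow> hessian_neg_def_at (\<lambda>q. exp (\<phi> q)) p"
  shows "(\<forall>\<gamma>. primal_geodesic \<phi> \<gamma> \<longrightarrow> \<gamma> ` {0..1} = closed_segment (\<gamma> 0) (\<gamma> 1)) \<and>
         (\<forall>\<gamma>. dual_geodesic \<phi> \<gamma> \<longrightarrow>
           (\<lambda>t. dual_euclid \<phi> (\<gamma> t)) ` {0..1} =
             closed_segment (dual_euclid \<phi> (\<gamma> 0)) (dual_euclid \<phi> (\<gamma> 1)))"
proof -
  interpret strictly_exp_concave \<phi>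
    by unfold_locales (use assms in auto)
  show ?thesis using primal_geodesic_image dual_geodesic_image by blast
qed

end
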